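(* Suppose that $V$ belongs to the class $\mathfrak C$ (defined in the context, with associated constant $V^*>0$ and set $B$). Consider initial data $(\phi_0,\dot\phi_0)=(\phi(0),\dot\phi(0))$ with $\phi_0\in B$ satisfying the weak energy condition $\epsilon(0)=\dot\phi_0^2+2V(\phi_0)\ge 0$. Then, except at most for a set of such initial data of measure zero, there exists $t_s\in\mathbb R$ such that the corresponding collapsing scalar field solution $(a,\phi)$ becomes singular at $t=t_s$, that is $$\lim_{t\to t_s^-}\epsilon(t)=+\infty\quad\text{and}\quad \lim_{t\to t_s^-}a(t)=0.$$ Moreover $\lim_{t\to t_s^-}|\dot\phi(t)|=+\infty$.
   Context: Class $\mathfrak V$: functions $V:\mathbb R\to\mathbb R$ such that (i) $V$ is $C^2$ and bounded from below; (ii) the critical points of $V$ are isolated, and each is either a (local) minimum point or a nondegenerate (local) maximum point. Class $\mathfrak C$: functions $V\in\mathfrak V$ for which there is a constant $V^*>0$ such that the set $B:=\{\phi\in\mathbb R: V(\phi)\le V^*\}$ is bounded, $V'(\phi)>0$ for all $\phi\ge\sup B$, $V'(\phi)<0$ for all $\phi\le\inf B$, and such that the function $u(\phi):=\frac{V'(\phi)}{2\sqrt3\,V(\phi)}$ (defined for large $|\phi|$) satisfies $\limsup_{\phi\to\pm\infty}|u(\phi)|<1$ and $\lim_{\phi\to\pm\infty}u'(\phi)$ exists and equals $0$. A constant $V^*>0$ such that $B=\{\phi\in\mathbb R: V(\phi)\le V^*\}$ is bounded, $V'(\phi)>0$ for all $\phi\ge\sup B$ and $V'(\phi)<0$ for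 all $\phi\le\inf B$ is fixed. Collapsing model: for a scale factor $a(t)>0$ and a scalar field $\phi(t)$ put $\epsilon(t)=\dot\phi(t)^2+2V(\phi(t))$ (energy density). The collapsing equations are $$\frac{\dot a}{a}=-\sqrt{\frac{\epsilon}{3}},\qquad \ddot\phi+V'(\phi)=\sqrt3\sqrt{\epsilon}\,\dot\phi ,$$ with initial time $t=0$ and $a(0)>0$. They are the Einstein field equations $3\dot a^2/a^2=\dot\phi^2+2V(\phi)$, $(\dot a^2+2a\ddot a)/a^2=-(\dot\phi^2-2V(\phi))$ for the metric $-dt^2+a^2(t)\,(dx_1^2+dx_2^2+dx_3^2)$ in the case $\dot a<0$; functions $\phi$ with non-constant $\phi$ and $\epsilon\equiv 0$ on an interval are not solutions of the Einstein equations and are not considered, so $\epsilon(t)>0$ for $t>0$ along a collapsing solution. The solution is taken on its maximal interval of existence to the right of $t=0$. Measure zero refers to Lebesgue measure on the set of initial data $(\phi_0,\dot\phi_0)\in\mathbb R^2$. *)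

theory Defs
  imports "HOL-Analysis.Analysis"
begin

definition class_V :: "(real \<Rightarrow> real) \<Rightarrow> bool" where
  "class_V V \<longleftrightarrow>
     V C1_differentiable_on UNIV \<and> deriv V C1_differentiable_on UNIV \<and>
     bdd_below (range V) \<and>
     discrete {x. deriv V x = 0} \<and>
     (\<forall>x. deriv V x = 0 \<longrightarrow>
        (\<forall>\<^sub>F y in nhds x. V x \<le> V y) \<or>
        ((\<forall>\<^sub>F y in nhds x. V y \<le> V x) \<and> deriv (deriv V) x \<noteq> 0))"

definition sublevel :: "(real \<Rightarrow> real) \<Rightarrow> real \<Rightarrow> real set" where
  "sublevel V c = {x. V x \<le> c}"

text \<open>
  Nonemptiness is no extra restriction: with the usual conventions for the supremum and infimum
  of the empty set, an empty sublevel set would require the derivative of \<open>V\<close> to be everywhere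
  both positive and negative. It is stated because \<open>Sup\<close> and \<open>Inf\<close> of the empty set carry no
  information on type \<open>real\<close>.
\<close>

definition confining_level :: "(real \<Rightarrow> real) \<Rightarrow> real \<Rightarrow> bool" where
  "confining_level V c \<longleftrightarrow>
     0 < c \<and> sublevel V c \<noteq> {} \<and> bounded (sublevel V c) \<and>
     (\<forall>x \<ge> Sup (sublevel V c). 0 < deriv V x) \<and>
     (\<forall>x \<le> Inf (sublevel V c). deriv V x < 0)"

text \<open>
  Only the behaviour of \<open>log_slope V\<close> for large arguments matters, where \<open>V\<close> is positive;
  its values at zeros of \<open>V\<close> are irrelevant.
\<close>

definition log_slope :: "(real \<Rightarrow> real) \<Rightarrow> real \<Rightarrow> real" where
  "log_slope V x = deriv V x / (2 * sqrt 3 * V x)"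

definition class_C :: "(real \<Rightarrow> real) \<Rightarrow> bool" where
  "class_C V \<longleftrightarrow>
     class_V V \<and> (\<exists>c. confining_level V c) \<and>
     Limsup at_top (\<lambda>x. ereal \<bar>log_slope V x\<bar>) < 1 \<and>
     Limsup at_bot (\<lambda>x. ereal \<bar>log_slope V x\<bar>) < 1 \<and>
     (deriv (log_slope V) \<longlongrightarrow> 0) at_top \<and>
     (deriv (log_slope V) \<longlongrightarrow> 0) at_bot"

text \<open>The energy density at field value \<open>x\<close> and field velocity \<open>w\<close>.\<close>

definition energy :: "(real \<Rightarrow> real) \<Rightarrow> real \<Rightarrow> real \<Rightarrow> real" where
  "energy V x w = w\<^sup>2 + 2 * V x"

definition lifespan :: "ereal \<Rightarrow> real set" where
  "lifespan T = {t. 0 \<le> t \<and> ereal t < T}"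

text \<open>
  A solution on \<open>[0, T)\<close>, where \<open>T\<close> may be infinite, consists of the scale factor \<open>a\<close>, the field
  \<open>\<phi>\<close> and its time derivative \<open>v\<close>; derivatives at time \<open>0\<close> are one-sided, and values outside
  \<open>[0, T)\<close> are irrelevant. Positivity of the energy density for positive times excludes the
  spurious curves of vanishing energy density, which do not solve the Einstein equations.
\<close>

definition collapsing_solution ::
  "(real \<Rightarrow> real) \<Rightarrow> ereal \<Rightarrow> (real \<Rightarrow> real) \<Rightarrow> (real \<Rightarrow> real) \<Rightarrow> (real \<Rightarrow> real) \<Rightarrow> bool" where
  "collapsing_solution V T a \<phi> v \<longleftrightarrow>
     0 < T \<and>
     (\<forall>t \<in> lifespan T.
        0 < a t \<and>
        0 \<le> energy V (\<phi> t) (v t) \<and>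
        (0 < t \<longrightarrow> 0 < energy V (\<phi> t) (v t)) \<and>
        (\<exists>a'. (a has_real_derivative a') (at t within lifespan T) \<and>
              a' / a t = - sqrt (energy V (\<phi> t) (v t) / 3)) \<and>
        (\<phi> has_real_derivative v t) (at t within lifespan T) \<and>
        (\<exists>v'. (v has_real_derivative v') (at t within lifespan T) \<and>
              v' + deriv V (\<phi> t) = sqrt 3 * sqrt (energy V (\<phi> t) (v t)) * v t))"

definition maximal_collapsing_solution ::
  "(real \<Rightarrow> real) \<Rightarrow> ereal \<Rightarrow> (real \<Rightarrow> real) \<Rightarrow> (real \<Rightarrow> real) \<Rightarrow> (real \<Rightarrow> real) \<Rightarrow> bool" where
  "maximal_collapsing_solution V T a \<phi> v \<longleftrightarrow>
     collapsing_solution V T a \<phi> v \<and>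
     \<not> (\<exists>T' b \<psi> w. T < T' \<and> collapsing_solution V T' b \<psi> w \<and>
          (\<forall>t \<in> lifespan T. b t = a t \<and> \<psi> t = \<phi> t \<and> w t = v t))"

text \<open>
  All functions are total, so reaching the singularity at time \<open>s\<close> includes that the interval of
  existence \<open>[0, T)\<close> ends exactly at \<open>s\<close>; otherwise the left limits could concern values outside
  the interval of existence.
\<close>

definition singular_at ::
  "(real \<Rightarrow> real) \<Rightarrow> ereal \<Rightarrow> (real \<Rightarrow> real) \<Rightarrow> (real \<Rightarrow> real) \<Rightarrow> (real \<Rightarrow> real) \<Rightarrow> real \<Rightarrow> bool" where
  "singular_at V T a \<phi> v s \<longleftrightarrow>
     T = ereal s \<and>
     filterlim (\<lambda>t. energy V (\<phi> t) (v t)) at_top (at_left s) \<and>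
     (a \<longlongrightarrow> 0) (at_left s)"

end

theory Submission
  imports Defs "HOL-Real_Asymp.Real_Asymp"
begin

text \<open>
  The scalar field equations expand areas in the plane of pairs \<open>(\<phi>, v)\<close>, and this makes the
  exceptional data rare. Along a collapsing solution the energy density satisfies
  \<open>\<epsilon>' = 2 \<surd>3 \<surd>\<epsilon> v\<^sup>2\<close>, so it increases. Let \<open>\<tau>\<close> be the time with \<open>d\<tau>/dt = \<surd>\<epsilon>\<close>; it is a
  multiple of the logarithm of \<open>a(0)/a\<close>. In this time the equations read
  \<open>d\<phi>/d\<tau> = \<partial>H/\<partial>v\<close>, \<open>dv/d\<tau> = -\<partial>H/\<partial>\<phi> + \<surd>3 v\<close> with \<open>H = \<surd>\<epsilon>\<close>: a Hamiltonian field plus a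
  linear one, of constant divergence \<open>\<surd>3\<close>. Hence areas grow exactly like \<open>exp(\<surd>3 \<tau>)\<close>.

  Fix \<open>\<theta> < 1\<close> and consider the data in a bounded region, with initial energy density bounded away
  from zero, for which \<open>\<epsilon> \<le> exp(2 \<surd>3 \<theta> n)\<close> still holds at \<open>\<tau> = n\<close>. At that time \<open>\<bar>v\<bar>\<close> is at most
  of order \<open>exp(\<surd>3 \<theta> n)\<close>, because \<open>V\<close> is bounded below, while \<open>\<bar>\<phi>\<bar>\<close> is at most of order \<open>n\<close>,
  because \<open>\<bar>d\<phi>/d\<tau>\<bar> = \<bar>v\<bar>/\<surd>\<epsilon>\<close> is bounded. So these data are carried into a box of area
  \<open>O(n exp(\<surd>3 \<theta> n))\<close> by a map that multiplies areas by \<open>exp(\<surd>3 n)\<close>, and their measure is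
  \<open>O(n exp(-\<surd>3 (1 - \<theta>) n))\<close>. This is summable, and the Borel-Cantelli lemma gives
  \<open>\<epsilon> \<ge> exp(2 \<surd>3 \<theta> (\<tau> - 1))\<close> for all large \<open>\<tau>\<close>, for almost all data (\<open>AE_fast_growth\<close>).

  Fast growth and an exponential bound on \<open>V\<close> imply the singularity (\<open>fast_growth_imp_singular\<close>).
  A maximal solution reaches every value of \<open>\<tau>\<close>, for otherwise its energy density would stay bounded on a bounded time
  interval and Picard's theorem would extend it. The time \<open>t = \<integral> d\<tau>/\<surd>\<epsilon>\<close> converges, so the
  solution ends at a finite \<open>t\<^sub>s\<close>, where \<open>\<epsilon> \<rightarrow> \<infinity>\<close> and \<open>a = a(0) exp(-\<tau>/\<surd>3) \<rightarrow> 0\<close>. Finally, the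
  bound on the logarithmic slope gives \<open>V(x) \<le> K exp(2 \<surd>3 (1 - \<eta>) \<bar>x\<bar>)\<close>, and \<open>v\<^sup>2 \<le> (1 + \<eta>)\<^sup>2 \<epsilon>\<close>
  at late times gives \<open>\<bar>\<phi>\<bar> \<le> const + (1 + \<eta>) \<tau>\<close>. So \<open>V(\<phi>)\<close> is at most of order
  \<open>exp(2 \<surd>3 (1 - \<eta>\<^sup>2) \<tau>)\<close>, which is negligible against \<open>\<epsilon>\<close> once \<open>\<theta> > 1 - \<eta>\<^sup>2\<close>, and
  \<open>v\<^sup>2 = \<epsilon> - 2 V(\<phi>) \<rightarrow> \<infinity>\<close>.

  Data with \<open>\<epsilon> = 0\<close>, where the square root is not Lipschitz, form a null set and are discarded.
\<close>

section \<open>Area growth along an expanding planar flow\<close>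

lemma measure_image_expanding:
  fixes g :: "real^'n::{finite,wellorder} \<Rightarrow> real^'n::_"
  assumes "compact S" and der: "\<And>z. z \<in> S \<Longrightarrow> (g has_derivative g' z) (at z)"
    and inj: "inj_on g S" and c: "\<And>z. z \<in> S \<Longrightarrow> c \<le> \<bar>det (matrix (g' z))\<bar>"
  shows "c * measure lebesgue S \<le> measure lebesgue (g ` S)"
proof -
  have der': "\<And>z. z \<in> S \<Longrightarrow> (g has_derivative g' z) (at z within S)"
    using der has_derivative_at_withinI by blast
  have contg: "continuous_on S g"
    using has_derivative_continuous_on[OF der'] .
  have S: "S \<in> lmeasurable" "S \<in> sets lebesgue" and gS: "g ` S \<in> lmeasurable"
    using \<open>compact S\<close> lmeasurable_compact compact_continuous_image[OF contg] by auto
  have int: "(\<lambda>x. \<bar>det (matrix (g' x))\<bar>) integrable_on S"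
    using measurable_differentiable_image_eq[OF S(2) der' inj] gS by blast
  have "c * measure lebesgue S = integral S (\<lambda>_. c * 1)"
    by (simp only: lmeasure_integral[OF S(1)] integral_mult_right)
  also have "\<dots> \<le> integral S (\<lambda>x. \<bar>det (matrix (g' x))\<bar>)"
    using c int S(1) by (intro integral_le integrable_on_const) auto
  also have "\<dots> = measure lebesgue (g ` S)"
    by (rule measure_differentiable_image_eq[OF S(2) der' inj int, symmetric])
  finally show ?thesis .
qed

lemma measure_iterate_expanding:
  fixes g :: "real^'n::{finite,wellorder} \<Rightarrow> real^'n::_"
  assumes "compact S" and der: "\<And>z. (g has_derivative g' z) (at z)"
    and "0 \<le> c"
    and "\<And>i. i < n \<Longrightarrow> inj_on g ((g ^^ i) ` S)"
    and "\<And>i z. i < n \<Longrightarrow> z \<in> S \<Longrightarrow> c \<le> \<bar>det (matrix (g' ((g ^^ i) z)))\<bar>"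
  shows "c ^ n * measure lebesgue S \<le> measure lebesgue ((g ^^ n) ` S)"
  using assms(4,5)
proof (induction n)
  case (Suc n)
  have contg: "continuous_on UNIV g"
    using der has_derivative_continuous_on by blast
  have cont: "continuous_on UNIV (g ^^ i)" for i
  proof (induction i)
    case (Suc i)
    then show ?case
      using continuous_on_compose2[OF contg, of UNIV "g ^^ i"] by (simp add: o_def)
  qed (simp add: continuous_on_id id_def)
  have "compact ((g ^^ n) ` S)"
    using \<open>compact S\<close> cont by (meson compact_continuous_image continuous_on_subset subset_UNIV)
  then have "c * measure lebesgue ((g ^^ n) ` S) \<le> measure lebesgue (g ` (g ^^ n) ` S)"
    using der Suc.prems[of n] Suc.prems(2)[of n]
    by (intro measure_image_expanding[where g' = g']) auto
  moreover have "c * (c ^ n * measure lebesgue S) \<le> c * measure lebesgue ((g ^^ n) ` S)"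
    using Suc \<open>0 \<le> c\<close> by (intro mult_left_mono) auto
  ultimately show ?case by (simp add: image_comp mult.assoc)
qed simp

lemma C1_imp_lipschitz_on_cball:
  fixes F :: "'a::euclidean_space \<Rightarrow> 'b::real_normed_vector"
  assumes der: "\<And>z. (F has_derivative F' z) (at z)"
    and cont: "\<And>k. continuous_on UNIV (\<lambda>z. F' z k)"
  shows "\<exists>L\<ge>0. \<forall>x\<in>cball z0 R. \<forall>y\<in>cball z0 R. norm (F x - F y) \<le> L * norm (x - y)"
proof -
  have "bounded ((\<lambda>z. \<Sum>b\<in>Basis. norm (F' z b)) ` cball z0 R)"
    by (intro compact_imp_bounded compact_continuous_image compact_cball continuous_intros
        continuous_on_subset[OF cont] subset_UNIV)
  then obtain L where L: "0 < L" "\<And>z. z \<in> cball z0 R \<Longrightarrow> (\<Sum>b\<in>Basis. norm (F' z b)) \<le> L"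
    unfolding bounded_pos by force
  have "onorm (F' z) \<le> L" if "z \<in> cball z0 R" for z
    using onorm_componentwise[OF has_derivative_bounded_linear[OF der[of z]]] L(2)[OF that]
    by linarith
  then have "norm (F x - F y) \<le> L * norm (x - y)" if "x \<in> cball z0 R" "y \<in> cball z0 R" for x y
    using that der has_derivative_at_withinI
    by (intro differentiable_bound[where S = "cball z0 R" and f' = F']) blast+
  with L(1) show ?thesis by (metis less_imp_le)
qed

text \<open>
  Euler steps are differentiable maps with explicit Jacobians, so they take the place of the flow
  in the area estimate. They follow every solution in a given ball with an error that is uniform over
  these solutions.
\<close>

lemma euler_scheme_error:
  fixes F :: "'a::real_inner \<Rightarrow> 'a" and w :: "real \<Rightarrow> 'a"
  assumes contw: "continuous_on {0..N} w"
    and derw: "\<And>s. s \<in> {0<..<N} \<Longrightarrow> (w has_vector_derivative F (w s)) (at s)"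
    and wR: "\<And>s. s \<in> {0..N} \<Longrightarrow> norm (w s) \<le> R"
    and lip: "\<And>x y. norm x \<le> R + 1 \<Longrightarrow> norm y \<le> R + 1 \<Longrightarrow> norm (F x - F y) \<le> L * norm (x - y)"
    and M: "\<And>x. norm x \<le> R + 1 \<Longrightarrow> norm (F x) \<le> M"
    and "0 \<le> L" "0 \<le> M" "0 < h" and hN: "real n * h = N"
    and small: "L * M * N * h * exp (L * N) \<le> 1"
  shows "i \<le> n \<Longrightarrow> norm (((\<lambda>z. z + h *\<^sub>R F z) ^^ i) (w 0) - w (real i * h))
           \<le> L * M * (real i * h) * h * exp (L * (real i * h))"
proof (induction i)
  case (Suc i)
  define s where "s = real i * h"
  define z where "z = ((\<lambda>z. z + h *\<^sub>R F z) ^^ i) (w 0)"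
  have s: "0 \<le> s" "s + h \<le> N"
    using Suc.prems \<open>0 < h\<close> hN mult_right_mono[of "real (Suc i)" "real n" h]
    by (auto simp: s_def algebra_simps)
  have IH: "norm (z - w s) \<le> L * M * s * h * exp (L * s)"
    using Suc by (simp add: z_def s_def)
  also have "\<dots> \<le> L * M * N * h * exp (L * N)"
    using s \<open>0 \<le> L\<close> \<open>0 \<le> M\<close> \<open>0 < h\<close> by (intro mult_mono) (auto intro: mult_left_mono)
  finally have zR: "norm z \<le> R + 1"
    using small wR[of s] s \<open>0 < h\<close> norm_triangle_sub[of z "w s"] by auto
  have speed: "norm (w r - w s) \<le> M * (r - s)" if r: "s \<le> r" "r \<le> s + h" for r
  proof (cases "r = s")
    case False
    have "\<exists>x\<in>{s<..<r}. norm (w r - w s) \<le> norm ((r - s) *\<^sub>R F (w x))"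
    proof (rule mvt_general)
      show "s < r" using False r by simp
      show "continuous_on {s..r} w"
        by (rule continuous_on_subset[OF contw]) (use s r in auto)
      show "(w has_derivative (\<lambda>k. k *\<^sub>R F (w x))) (at x)" if "s < x" "x < r" for x
        using derw[of x] that s r by (auto simp: has_vector_derivative_def)
    qed
    then obtain x where x: "x \<in> {s<..<r}" "norm (w r - w s) \<le> norm ((r - s) *\<^sub>R F (w x))" by blast
    have "norm (F (w x)) \<le> M"
      using x s r wR[of x] by (intro M) auto
    then have "(r - s) * norm (F (w x)) \<le> (r - s) * M"
      using r by (intro mult_left_mono) auto
    then show ?thesis using x(2) r by (simp add: mult.commute)
  qed simp
  have "\<exists>x\<in>{s<..<s+h}. norm ((w (s+h) - (s+h) *\<^sub>R F (w s)) - (w s - s *\<^sub>R F (w s)))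
           \<le> norm (((s+h) - s) *\<^sub>R F (w x) - ((s+h) - s) *\<^sub>R F (w s))"
  proof (rule mvt_general)
    show "s < s + h" using \<open>0 < h\<close> by simp
    show "continuous_on {s..s+h} (\<lambda>r. w r - r *\<^sub>R F (w s))"
      by (intro continuous_intros continuous_on_subset[OF contw]) (use s in auto)
    show "((\<lambda>r. w r - r *\<^sub>R F (w s)) has_derivative (\<lambda>k. k *\<^sub>R F (w x) - k *\<^sub>R F (w s))) (at x)"
      if "s < x" "x < s + h" for x
      using derw[of x] that s by (auto simp: has_vector_derivative_def intro!: derivative_eq_intros)
  qed
  then obtain x where x: "x \<in> {s<..<s+h}"
    and "norm ((w (s+h) - (s+h) *\<^sub>R F (w s)) - (w s - s *\<^sub>R F (w s))) \<le> norm (h *\<^sub>R (F (w x) - F (w s)))"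
    by (auto simp: algebra_simps)
  then have "norm (w (s+h) - w s - h *\<^sub>R F (w s)) \<le> norm (h *\<^sub>R (F (w x) - F (w s)))"
    by (simp add: algebra_simps)
  also have "\<dots> = h * norm (F (w x) - F (w s))"
    using \<open>0 < h\<close> by simp
  also have "\<dots> \<le> h * (L * norm (w x - w s))"
    using x s wR[of x] wR[of s] \<open>0 < h\<close> by (intro mult_left_mono lip) auto
  also have "\<dots> \<le> h * (L * (M * h))"
    using speed[of x] mult_left_mono[of "x - s" h M] x \<open>0 < h\<close> \<open>0 \<le> L\<close> \<open>0 \<le> M\<close>
    by (intro mult_left_mono) auto
  finally have local: "norm (w (s+h) - w s - h *\<^sub>R F (w s)) \<le> L * M * h * h"
    by (simp add: algebra_simps)
  have "norm (z + h *\<^sub>R F z - w (s+h))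
      = norm ((z - w s) + h *\<^sub>R (F z - F (w s)) - (w (s+h) - w s - h *\<^sub>R F (w s)))"
    by (simp add: algebra_simps)
  also have "\<dots> \<le> norm (z - w s) + h * norm (F z - F (w s)) + L * M * h * h"
    using local \<open>0 < h\<close> by (smt (verit) norm_triangle_ineq norm_triangle_ineq4 norm_scaleR abs_of_pos)
  also have "\<dots> \<le> norm (z - w s) + h * (L * norm (z - w s)) + L * M * h * h"
    using zR wR[of s] s \<open>0 < h\<close> by (intro add_right_mono add_left_mono mult_left_mono lip) auto
  also have "\<dots> = (1 + L * h) * norm (z - w s) + L * M * h * h" by (simp add: algebra_simps)
  also have "\<dots> \<le> exp (L * h) * (L * M * s * h * exp (L * s)) + L * M * h * h * exp (L * (s + h))"
  proof (rule add_mono)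
    show "(1 + L * h) * norm (z - w s) \<le> exp (L * h) * (L * M * s * h * exp (L * s))"
      using IH by (intro mult_mono exp_ge_add_one_self) auto
    show "L * M * h * h \<le> L * M * h * h * exp (L * (s + h))"
      using \<open>0 \<le> L\<close> \<open>0 \<le> M\<close> \<open>0 < h\<close> s
        mult_left_mono[of 1 "exp (L * (s + h))" "L * M * h * h"] by simp
  qed
  also have "\<dots> = L * M * (s + h) * h * exp (L * (s + h))"
    by (simp add: algebra_simps exp_add)
  finally show ?case
    by (simp add: s_def z_def algebra_simps)
qed simp

text \<open>
  To first order in the step size, an Euler step changes areas by the divergence of the field.
\<close>

lemma euler_step_det:
  fixes A :: "real^2 \<Rightarrow> real^2"
  assumes "linear A"
  shows "det (matrix (\<lambda>k. k + h *\<^sub>R A k))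
         = 1 + h * (A (axis 1 1) $ 1 + A (axis 2 1) $ 2)
             + h\<^sup>2 * (A (axis 1 1) $ 1 * A (axis 2 1) $ 2 - A (axis 2 1) $ 1 * A (axis 1 1) $ 2)"
  by (simp add: det_2 matrix_def axis_def algebra_simps power2_eq_square)

text \<open>
  The Jacobians of the Euler steps multiply to the factor \<open>exp (d * N)\<close> of the exact flow, up to a
  factor 2, as soon as the accumulated second order terms are below \<open>ln 2\<close>.
\<close>

lemma euler_area_factor:
  fixes d C h N :: real
  assumes "0 < h" "real n * h = N" "0 \<le> C" "h * C \<le> d" "d * h \<le> 1" "N * (C + d\<^sup>2) * h \<le> ln 2"
  shows "exp (d * N) \<le> 2 * (1 + d * h - C * h\<^sup>2) ^ n"
proof -
  define y where "y = d * h - C * h\<^sup>2"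
  have "h * (h * C) \<le> h * d" using assms by (intro mult_left_mono) auto
  then have y0: "0 \<le> y" by (simp add: y_def power2_eq_square algebra_simps)
  have yd: "y \<le> d * h" using assms by (simp add: y_def)
  then have y1: "y \<le> 1" using assms by simp
  have "y\<^sup>2 \<le> (d * h)\<^sup>2" using y0 yd by (intro power_mono)
  moreover have "y - y\<^sup>2 \<le> ln (1 + y)" using ln_one_plus_pos_lower_bound[OF y0 y1] .
  ultimately have "d * h - (C + d\<^sup>2) * h\<^sup>2 \<le> ln (1 + y)"
    by (simp add: y_def algebra_simps)
  then have "real n * (d * h - (C + d\<^sup>2) * h\<^sup>2) \<le> real n * ln (1 + y)"
    by (intro mult_left_mono) auto
  moreover have "real n * (d * h - (C + d\<^sup>2) * h\<^sup>2) = d * N - N * (C + d\<^sup>2) * h"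
    using assms(2) by (auto simp: algebra_simps power2_eq_square)
  ultimately have "d * N \<le> ln 2 + real n * ln (1 + y)" using assms by linarith
  then have "exp (d * N) \<le> exp (ln 2 + real n * ln (1 + y))" by simp
  also have "\<dots> = 2 * (1 + y) ^ n"
    using y0 by (simp add: exp_add exp_of_nat_mult)
  finally show ?thesis by (simp add: y_def add_diff_eq)
qed

text \<open>
  The initial points of all solutions that end well inside \<open>B\<close> form a set whose image under the flow
  lies in \<open>B\<close> and is larger by the factor \<open>exp (d * N)\<close>. The set \<open>S\<close> is defined by the Euler
  scheme: it consists of the points whose Euler polygon stays in a large ball and ends in \<open>B\<close>. This
  set is compact, hence measurable, while the set of initial points itself need not be.
\<close>

proposition area_bound_of_expanding_flow:
  fixes F :: "real^2 \<Rightarrow> real^2"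
  assumes der: "\<And>z. (F has_derivative F' z) (at z)"
    and cont: "\<And>k. continuous_on UNIV (\<lambda>z. F' z k)"
    and div: "\<And>z. F' z (axis 1 1) $ 1 + F' z (axis 2 1) $ 2 = d"
    and "0 < d" "0 < N" "compact B"
  shows "\<exists>S. compact S \<and> measure lebesgue S \<le> 2 * exp (- d * N) * measure lebesgue B \<and>
           (\<forall>w. continuous_on {0..N} w \<longrightarrow>
                (\<forall>s\<in>{0<..<N}. (w has_vector_derivative F (w s)) (at s)) \<longrightarrow>
                (\<forall>s\<in>{0..N}. norm (w s) \<le> R) \<longrightarrow> cball (w N) 1 \<subseteq> B \<longrightarrow> w 0 \<in> S)"
proof -
  define Q where "Q = cball (0 :: real^2) (R + 1)"
  obtain L where "0 \<le> L"
    and lip: "\<And>x y. norm x \<le> R + 1 \<Longrightarrow> norm y \<le> R + 1 \<Longrightarrow> norm (F x - F y) \<le> L * norm (x - y)"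
    using C1_imp_lipschitz_on_cball[OF der cont, of 0 "R + 1"] by auto
  have contF: "continuous_on UNIV F"
    using der has_derivative_continuous_on by blast
  have "bounded (F ` Q)"
    unfolding Q_def using continuous_on_subset[OF contF]
    by (intro compact_imp_bounded compact_continuous_image) auto
  then obtain M where "0 < M" and M: "\<And>x. norm x \<le> R + 1 \<Longrightarrow> norm (F x) \<le> M"
    unfolding bounded_pos Q_def by force
  define J where "J z = F' z (axis 1 1) $ 1 * F' z (axis 2 1) $ 2 - F' z (axis 2 1) $ 1 * F' z (axis 1 1) $ 2" for z
  have "bounded (J ` Q)"
    unfolding Q_def J_def
    by (intro compact_imp_bounded compact_continuous_image compact_cball continuous_intros
        continuous_on_component continuous_on_subset[OF cont] subset_UNIV)
  then obtain C where "0 < C" and C: "\<And>x. x \<in> Q \<Longrightarrow> \<bar>J x\<bar> \<le> C"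
    unfolding bounded_pos by force
  have ev: "\<forall>\<^sub>F n in sequentially. N / real n * c < e" if "0 < e" for c e :: real
    using tendsto_mult_left_zero[OF lim_const_over_n[of N], of c] order_tendstoD(2) that by blast
  have "\<forall>\<^sub>F n in sequentially. n > 0 \<and> N / real n * L < 1 \<and> N / real n * (L * M * N * exp (L * N)) < 1
     \<and> N / real n * C < d \<and> N / real n * d < 1 \<and> N / real n * (N * (C + d\<^sup>2)) < ln 2"
    using \<open>0 < d\<close> by (intro eventually_conj ev eventually_gt_at_top) auto
  then obtain n where n: "n > 0" "N / real n * L < 1" "N / real n * (L * M * N * exp (L * N)) < 1"
     "N / real n * C < d" "N / real n * d < 1" "N / real n * (N * (C + d\<^sup>2)) < ln 2"
    by (metis (no_types, lifting) eventually_happens trivial_limit_sequentially)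
  define h where "h = N / real n"
  have h: "0 < h" "real n * h = N" using n \<open>0 < N\<close> by (auto simp: h_def)
  note n = n[folded h_def]
  define E where "E = (\<lambda>z. z + h *\<^sub>R F z)"
  define E' where "E' = (\<lambda>z k. k + h *\<^sub>R F' z k)"
  have derE: "(E has_derivative E' z) (at z)" for z
    unfolding E_def E'_def by (intro derivative_intros der)
  have contE: "continuous_on UNIV (E ^^ i)" for i
  proof (induction i)
    case (Suc i)
    have "continuous_on UNIV E"
      using derE has_derivative_continuous_on by blast
    from continuous_on_compose2[OF this Suc] show ?case by (simp add: o_def)
  qed (simp add: continuous_on_id id_def)
  \<comment> \<open>Since \<open>h * L < 1\<close>, the step differs from the identity by a contraction.\<close>
  have inj: "inj_on E Q"
  proof (rule inj_onI)
    fix x y assume xy: "x \<in> Q" "y \<in> Q" "E x = E y"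
    then have "x - y = h *\<^sub>R (F y - F x)"
      unfolding E_def by (simp add: algebra_simps)
    then have "norm (x - y) = h * norm (F y - F x)"
      using h by simp
    also have "\<dots> \<le> h * (L * norm (y - x))"
      using xy h by (intro mult_left_mono lip) (auto simp: Q_def)
    finally have "norm (x - y) \<le> (h * L) * norm (x - y)" by (simp add: norm_minus_commute)
    moreover have "(h * L) * norm (x - y) < 1 * norm (x - y)" if "x \<noteq> y"
      using that n by (intro mult_strict_right_mono) auto
    ultimately show "x = y" by fastforce
  qed
  define S where "S = (\<Inter>i\<in>{..n}. (E ^^ i) -` Q) \<inter> (E ^^ n) -` B"
  have "closed S"
    unfolding S_def using contE \<open>compact B\<close> compact_imp_closed
    by (intro closed_Int closed_INT ballI closed_vimage) (auto simp: Q_def)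
  moreover have "S \<subseteq> Q" unfolding S_def by auto
  ultimately have "compact S"
    by (metis Q_def bounded_cball bounded_subset compact_eq_bounded_closed)
  have SQ: "(E ^^ i) z \<in> Q" if "i < n" "z \<in> S" for i z
    using that unfolding S_def by auto
  define c where "c = 1 + d * h - C * h\<^sup>2"
  have "h * (h * C) \<le> h * d" using n h by (intro mult_left_mono) auto
  then have c0: "0 \<le> c"
    by (simp add: c_def power2_eq_square algebra_simps)
  have "c ^ n * measure lebesgue S \<le> measure lebesgue ((E ^^ n) ` S)"
  proof (rule measure_iterate_expanding[OF \<open>compact S\<close> derE c0])
    fix i assume "i < n"
    show "inj_on E ((E ^^ i) ` S)"
      by (rule inj_on_subset[OF inj]) (use SQ[OF \<open>i < n\<close>] in auto)
    fix z assume "z \<in> S"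
    then have "\<bar>J ((E ^^ i) z)\<bar> \<le> C" using C SQ \<open>i < n\<close> by blast
    then have "h\<^sup>2 * (- C) \<le> h\<^sup>2 * J ((E ^^ i) z)" by (intro mult_left_mono) auto
    moreover have "det (matrix (E' ((E ^^ i) z))) = 1 + h * d + h\<^sup>2 * J ((E ^^ i) z)"
      unfolding E'_def J_def
      by (subst euler_step_det) (auto simp: div has_derivative_linear[OF der])
    ultimately show "c \<le> \<bar>det (matrix (E' ((E ^^ i) z)))\<bar>"
      by (simp add: c_def mult.commute)
  qed
  also have "\<dots> \<le> measure lebesgue B"
  proof (rule measure_mono_fmeasurable)
    show "(E ^^ n) ` S \<subseteq> B" unfolding S_def by auto
    have "compact ((E ^^ n) ` S)"
      using \<open>compact S\<close> contE by (meson compact_continuous_image continuous_on_subset subset_UNIV)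
    then show "(E ^^ n) ` S \<in> sets lebesgue" using lmeasurable_compact by blast
    show "B \<in> lmeasurable" using \<open>compact B\<close> lmeasurable_compact by blast
  qed
  finally have "c ^ n * measure lebesgue S \<le> measure lebesgue B" .
  moreover have "exp (d * N) \<le> 2 * c ^ n"
    unfolding c_def using n h \<open>0 < C\<close>
    by (intro euler_area_factor) (auto simp: mult_ac)
  then have "exp (d * N) * measure lebesgue S \<le> (2 * c ^ n) * measure lebesgue S"
    by (intro mult_right_mono) auto
  ultimately have "exp (d * N) * measure lebesgue S \<le> 2 * measure lebesgue B"
    by simp
  then have "exp (- (d * N)) * (exp (d * N) * measure lebesgue S) \<le> exp (- (d * N)) * (2 * measure lebesgue B)"
    by (intro mult_left_mono) auto
  then have "measure lebesgue S \<le> 2 * exp (- d * N) * measure lebesgue B"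
    by (simp add: mult.assoc[symmetric] exp_add[symmetric])
  moreover have "w 0 \<in> S"
    if w: "continuous_on {0..N} w" "\<forall>s\<in>{0<..<N}. (w has_vector_derivative F (w s)) (at s)"
      "\<forall>s\<in>{0..N}. norm (w s) \<le> R" "cball (w N) 1 \<subseteq> B" for w
  proof -
    have close: "norm ((E ^^ i) (w 0) - w (real i * h)) \<le> 1" if "i \<le> n" for i
    proof -
      have ih: "real i * h \<le> N" "0 \<le> real i * h" using that h mult_right_mono[of "real i" "real n" h] by auto
      have "norm ((E ^^ i) (w 0) - w (real i * h)) \<le> L * M * (real i * h) * h * exp (L * (real i * h))"
        unfolding E_def
      proof (rule euler_scheme_error[OF w(1) _ _ lip M \<open>0 \<le> L\<close> _ h _ that])
        show "L * M * N * h * exp (L * N) \<le> 1" using n by (simp add: mult_ac)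
      qed (use w(2,3) \<open>0 < M\<close> in auto)
      also have "\<dots> \<le> L * M * N * h * exp (L * N)"
        using ih \<open>0 \<le> L\<close> \<open>0 < M\<close> h by (intro mult_mono) (auto intro: mult_left_mono)
      finally show ?thesis using n by (simp add: mult_ac)
    qed
    have "(E ^^ i) (w 0) \<in> Q" if "i \<le> n" for i
    proof -
      have "real i * h \<in> {0..N}" using that h mult_right_mono[of "real i" "real n" h] by auto
      then show ?thesis
        using close[OF that] w(3) norm_triangle_sub[of "(E ^^ i) (w 0)" "w (real i * h)"]
        unfolding Q_def by fastforce
    qed
    moreover have "(E ^^ n) (w 0) \<in> B"
      using close[of n] w(4) h by (auto simp: dist_norm norm_minus_commute)
    ultimately show ?thesis unfolding S_def by auto
  qed
  ultimately show ?thesis using \<open>compact S\<close> by blast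
qed

section \<open>Local existence for differential equations\<close>

text \<open>
  Picard iteration on the bounded continuous functions on the whole line. The field is composed with
  the projection onto the ball, which makes it globally Lipschitz, and the upper limit of the integral
  is clamped to \<open>[0, \<delta>]\<close>. On this interval the fixed point cannot leave the ball, so there the
  projection changes nothing.
\<close>

lemma ode_local_existence:
  fixes f :: "'a::euclidean_space \<Rightarrow> 'a"
  assumes lip: "\<And>x y. x \<in> cball x0 1 \<Longrightarrow> y \<in> cball x0 1 \<Longrightarrow> norm (f x - f y) \<le> L * norm (x - y)"
    and "0 \<le> L"
  shows "\<exists>\<delta>>0. \<exists>x. x 0 = x0 \<and> (\<forall>t\<in>{0..\<delta>}. (x has_vector_derivative f (x t)) (at t within {0..\<delta>}))"
proof -
  define M where "M = norm (f x0) + L"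
  \<comment> \<open>This makes the iteration a contraction (\<open>\<delta> * L < 1\<close>) whose fixed point moves by at most \<open>M * \<delta> \<le> 1\<close>.\<close>
  define \<delta> where "\<delta> = 1 / (L + M + 1)"
  define g where "g = f \<circ> closest_point (cball x0 1)"
  define cl where "cl t = max 0 (min \<delta> t)" for t :: real
  have "0 \<le> M" "0 < \<delta>" "\<delta> * L < 1" "M * \<delta> \<le> 1"
    using \<open>0 \<le> L\<close> by (auto simp: M_def \<delta>_def divide_simps add_nonneg_pos)
  have proj: "closest_point (cball x0 1) y \<in> cball x0 1" for y
    by (intro closest_point_in_set) auto
  have gM: "norm (g y) \<le> M" for y
  proof -
    let ?y = "closest_point (cball x0 1) y"
    have "norm (f ?y - f x0) \<le> L * norm (?y - x0)"
      using proj by (intro lip) auto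
    also have "\<dots> \<le> L * 1"
      using proj[of y] \<open>0 \<le> L\<close> by (intro mult_left_mono) (auto simp: dist_norm norm_minus_commute)
    finally show ?thesis
      using norm_triangle_sub[of "f ?y" "f x0"] by (simp add: g_def M_def)
  qed
  have gL: "norm (g x - g y) \<le> L * norm (x - y)" for x y
  proof -
    have "norm (g x - g y) \<le> L * norm (closest_point (cball x0 1) x - closest_point (cball x0 1) y)"
      unfolding g_def o_def by (intro lip proj)
    also have "\<dots> \<le> L * norm (x - y)"
      using closest_point_lipschitz[of "cball x0 1" x y] \<open>0 \<le> L\<close>
      by (intro mult_left_mono) (auto simp: dist_norm)
    finally show ?thesis .
  qed
  have contg: "continuous_on UNIV g"
    by (rule lipschitz_on_continuous_on[of L]) (use gL \<open>0 \<le> L\<close> in \<open>auto simp: lipschitz_on_def dist_norm\<close>)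
  have contgx: "continuous_on S (\<lambda>s. g (apply_bcontfun x s))" for S :: "real set" and x
    by (rule continuous_on_compose2[OF contg]) auto
  define T where "T x = Bcontfun (\<lambda>t. x0 + integral {0..cl t} (\<lambda>s. g (apply_bcontfun x s)))" for x
  have clin: "cl t \<in> {0..\<delta>}" for t using \<open>0 < \<delta>\<close> by (auto simp: cl_def)
  have T: "apply_bcontfun (T x) t = x0 + integral {0..cl t} (\<lambda>s. g (apply_bcontfun x s))" for x t
  proof -
    have "continuous_on UNIV (\<lambda>t. x0 + integral {0..cl t} (\<lambda>s. g (apply_bcontfun x s)))"
    proof (intro continuous_intros continuous_on_compose2[of "{0..\<delta>}" "\<lambda>u. integral {0..u} (\<lambda>s. g (apply_bcontfun x s))" UNIV cl])
      show "continuous_on {0..\<delta>} (\<lambda>u. integral {0..u} (\<lambda>s. g (apply_bcontfun x s)))"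
        by (intro indefinite_integral_continuous_1 integrable_continuous_real contgx)
      show "continuous_on UNIV cl" unfolding cl_def by (intro continuous_intros)
    qed (use clin in auto)
    moreover have "norm (x0 + integral {0..cl t} (\<lambda>s. g (apply_bcontfun x s))) \<le> norm x0 + M * \<delta>" for t
    proof -
      have "norm (integral {0..cl t} (\<lambda>s. g (apply_bcontfun x s))) \<le> M * (cl t - 0)"
        using clin[of t] gM by (intro integral_bound contgx) auto
      also have "\<dots> \<le> M * \<delta>" using clin[of t] \<open>0 \<le> M\<close> by (intro mult_left_mono) auto
      finally show ?thesis by (intro norm_triangle_le) simp
    qed
    ultimately have "(\<lambda>t. x0 + integral {0..cl t} (\<lambda>s. g (apply_bcontfun x s))) \<in> bcontfun"
      by (rule bcontfun_normI)
    then show ?thesis unfolding T_def by (simp add: Bcontfun_inverse)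
  qed
  have "dist (T x) (T y) \<le> (\<delta> * L) * dist x y" for x y
  proof (rule dist_bound)
    fix t
    have "dist (apply_bcontfun (T x) t) (apply_bcontfun (T y) t)
        = norm (integral {0..cl t} (\<lambda>s. g (apply_bcontfun x s) - g (apply_bcontfun y s)))"
      unfolding T dist_norm by (simp add: integral_diff integrable_continuous_real contgx)
    also have "\<dots> \<le> (L * dist x y) * (cl t - 0)"
    proof (rule integral_bound)
      show "norm (g (apply_bcontfun x s) - g (apply_bcontfun y s)) \<le> L * dist x y" for s
        using gL[of "apply_bcontfun x s" "apply_bcontfun y s"]
          mult_left_mono[OF dist_bounded[of x s y] \<open>0 \<le> L\<close>] by (simp add: dist_norm)
    qed (use clin[of t] in \<open>auto intro!: continuous_intros contgx\<close>)
    also have "\<dots> \<le> (L * dist x y) * \<delta>"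
      using clin[of t] \<open>0 \<le> L\<close> by (intro mult_left_mono) auto
    finally show "dist (apply_bcontfun (T x) t) (apply_bcontfun (T y) t) \<le> (\<delta> * L) * dist x y"
      by (simp add: mult_ac)
  qed
  then obtain x where x: "T x = x"
    using banach_fix_type[of "\<delta> * L" T] \<open>0 < \<delta>\<close> \<open>0 \<le> L\<close> \<open>\<delta> * L < 1\<close> by auto
  have xt: "apply_bcontfun x t = x0 + integral {0..t} (\<lambda>s. g (apply_bcontfun x s))" if "t \<in> {0..\<delta>}" for t
    using T[of x t] that by (simp add: x cl_def)
  have "((\<lambda>t. apply_bcontfun x t) has_vector_derivative f (apply_bcontfun x t)) (at t within {0..\<delta>})"
    if t: "t \<in> {0..\<delta>}" for t
  proof -
    have "norm (integral {0..t} (\<lambda>s. g (apply_bcontfun x s))) \<le> M * (t - 0)"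
      using t gM by (intro integral_bound contgx) auto
    also have "\<dots> \<le> M * \<delta>" using t \<open>0 \<le> M\<close> by (intro mult_left_mono) auto
    finally have "apply_bcontfun x t \<in> cball x0 1"
      using \<open>M * \<delta> \<le> 1\<close> unfolding xt[OF t] by (simp add: dist_norm)
    then have "g (apply_bcontfun x t) = f (apply_bcontfun x t)"
      by (simp add: g_def closest_point_self)
    moreover have "((\<lambda>t. x0 + integral {0..t} (\<lambda>s. g (apply_bcontfun x s)))
        has_vector_derivative (0 + g (apply_bcontfun x t))) (at t within {0..\<delta>})"
      by (intro has_vector_derivative_add integral_has_vector_derivative contgx t has_vector_derivative_const)
    ultimately have "((\<lambda>t. x0 + integral {0..t} (\<lambda>s. g (apply_bcontfun x s)))
        has_vector_derivative f (apply_bcontfun x t)) (at t within {0..\<delta>})" by simp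
    then show ?thesis
      by (rule has_vector_derivative_transform[OF t, of "apply_bcontfun x", rotated]) (rule xt)
  qed
  moreover have "apply_bcontfun x 0 = x0" using xt[of 0] \<open>0 < \<delta>\<close> by simp
  ultimately show ?thesis using \<open>0 < \<delta>\<close> by blast
qed

text \<open>
  Two solutions that are glued continuously at \<open>c\<close> solve the equation at \<open>c\<close> as well: the fundamental
  theorem of calculus tolerates one exceptional point, and an integral of a continuous function is
  differentiable everywhere.
\<close>

lemma has_vector_derivative_across_point:
  fixes f g :: "real \<Rightarrow> 'a::banach"
  assumes "continuous_on {a..b} f" "continuous_on {a..b} g"
    and der: "\<And>t. t \<in> {a<..<b} - {c} \<Longrightarrow> (f has_vector_derivative g t) (at t)"
    and t: "t \<in> {a..b}"
  shows "(f has_vector_derivative g t) (at t within {a..b})"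
proof -
  have f: "f u = f a + integral {a..u} g" if "u \<in> {a..b}" for u
  proof -
    have "(g has_integral (f u - f a)) {a..u}"
    proof (rule fundamental_theorem_of_calculus_interior_strong[of "{c}"])
      show "continuous_on {a..u} f" using assms(1) that by (auto intro: continuous_on_subset)
    qed (use that der in auto)
    then show ?thesis by (simp add: integral_unique)
  qed
  have "((\<lambda>u. f a + integral {a..u} g) has_vector_derivative 0 + g t) (at t within {a..b})"
    by (intro has_vector_derivative_add integral_has_vector_derivative assms t has_vector_derivative_const)
  then have "((\<lambda>u. f a + integral {a..u} g) has_vector_derivative g t) (at t within {a..b})"
    by simp
  then show ?thesis by (rule has_vector_derivative_transform[OF t, rotated]) (rule f)
qed

lemma bounded_derivative_continuous_extension:
  fixes f :: "real \<Rightarrow> real"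
  assumes "0 < T"
    and der: "\<And>t. t \<in> {0..<T} \<Longrightarrow> (f has_real_derivative f' t) (at t within {0..<T})"
    and M: "\<And>t. t \<in> {0..<T} \<Longrightarrow> \<bar>f' t\<bar> \<le> M"
  shows "\<exists>g. continuous_on {0..T} g \<and> (\<forall>t\<in>{0..<T}. g t = f t)"
proof -
  have "norm (f x - f y) \<le> M * norm (x - y)" if "x \<in> {0..<T}" "y \<in> {0..<T}" for x y
    using field_differentiable_bound[of "{0..<T}" f f' M x y] der M that by (auto simp: convex_real_interval)
  moreover have "0 \<le> M" using M[of 0] \<open>0 < T\<close> by auto
  ultimately have "M-lipschitz_on {0..<T} f"
    by (auto simp: lipschitz_on_def dist_norm)
  then have "uniformly_continuous_on {0..<T} f"
    by (rule lipschitz_on_uniformly_continuous)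
  then obtain g where "uniformly_continuous_on (closure {0..<T}) g" "\<And>x. x \<in> {0..<T} \<Longrightarrow> f x = g x"
    by (rule uniformly_continuous_on_extension_on_closure) blast
  then show ?thesis using \<open>0 < T\<close> uniformly_continuous_imp_continuous by (metis closure_atLeastLessThan)
qed

text \<open>
  Below \<open>c\<close> the inverse square root is continued by its tangent. Replacing \<open>1 / \<surd>\<epsilon>\<close> in this way makes
  the field equations continuously differentiable on the whole plane without changing them at energy
  densities of at least \<open>c\<close>.
\<close>

lemma inverse_sqrt_C1_extension:
  fixes c :: real
  assumes "0 < c"
  shows "\<exists>g g'. (\<forall>s. (g has_real_derivative g' s) (at s)) \<and> continuous_on UNIV g' \<and> (\<forall>s\<ge>c. g s = 1 / sqrt s)"
proof -
  define g' where "g' s = - 1 / (2 * max s c * sqrt (max s c))" for s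
  define g where "g s = 1 / sqrt (max s c) + (min s c - c) * g' c" for s
  have cont: "continuous_on S g'" "continuous_on S g" for S
    unfolding g'_def g_def using \<open>0 < c\<close> by (auto intro!: continuous_intros)
  have "(g has_vector_derivative g' s) (at s)" if "s \<noteq> c" for s
  proof (cases "s < c")
    case True
    have "((\<lambda>s. 1 / sqrt c + (s - c) * g' c) has_real_derivative g' s) (at s)"
      using True \<open>0 < c\<close> by (auto intro!: derivative_eq_intros simp: g'_def)
    then have "(g has_real_derivative g' s) (at s)"
      by (rule has_field_derivative_transform_within_open[of _ _ _ "{..<c}"])
         (use True in \<open>auto simp: g_def\<close>)
    then show ?thesis by (simp add: has_real_derivative_iff_has_vector_derivative)
  next
    case False
    have "((\<lambda>s. 1 / sqrt s) has_real_derivative g' s) (at s)"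
      using False \<open>0 < c\<close> by (auto intro!: derivative_eq_intros simp: g'_def field_simps power2_eq_square)
    then have "(g has_real_derivative g' s) (at s)"
      by (rule has_field_derivative_transform_within_open[of _ _ _ "{c<..}"])
         (use False that in \<open>auto simp: g_def\<close>)
    then show ?thesis by (simp add: has_real_derivative_iff_has_vector_derivative)
  qed
  then have "(g has_vector_derivative g' s) (at s within {s-1..s+1})" for s
    by (intro has_vector_derivative_across_point[where c = c] cont) auto
  then have local: "(g has_real_derivative g' s) (at s within {s-1..s+1})" for s
    by (simp add: has_real_derivative_iff_has_vector_derivative)
  have "(g has_real_derivative g' s) (at s)" for s
  proof -
    have "at s within {s-1..s+1} = at s" by (rule at_within_interior) simp
    then show ?thesis using local[of s] by simp
  qed
  moreover have "g s = 1 / sqrt s" if "c \<le> s" for s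
    using that by (simp add: g_def)
  ultimately show ?thesis using cont(1)[of UNIV] by blast
qed

section \<open>The scalar field equations as a planar system\<close>

definition pt :: "real \<Rightarrow> real \<Rightarrow> real^2" where
  "pt x y = x *\<^sub>R axis 1 1 + y *\<^sub>R axis 2 1"

lemma pt_nth [simp]: "pt x y $ 1 = x" "pt x y $ 2 = y"
  by (auto simp: pt_def axis_def)

lemma pt_eta [simp]: "pt (z $ 1) (z $ 2) = z"
  by (simp add: vec_eq_iff forall_2)

lemma norm_pt_le: "norm (z :: real^2) \<le> \<bar>z $ 1\<bar> + \<bar>z $ 2\<bar>"
  using norm_le_l1_cart[of z] by (simp add: sum_2)

locale bounded_below_potential =
  fixes V :: "real \<Rightarrow> real" and C :: real
  assumes V_deriv: "\<And>x. (V has_real_derivative deriv V x) (at x)"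
    and V'_deriv: "\<And>x. (deriv V has_real_derivative deriv (deriv V) x) (at x)"
    and V''_cont: "continuous_on UNIV (deriv (deriv V))"
    and C_nonneg: "0 \<le> C" and V_ge: "\<And>x. - C \<le> V x"
begin

lemma V_cont: "continuous_on S V" and V'_cont: "continuous_on S (deriv V)"
  by (meson DERIV_isCont V_deriv V'_deriv continuous_at_imp_continuous_on)+

text \<open>
  Both forms of the field equations that are used below. With \<open>p e = 1\<close> and \<open>s e = sqrt e\<close> this is the
  field in the time \<open>t\<close>. With \<open>p e = 1 / sqrt e\<close> and \<open>s e = 1\<close> it is the field divided by \<open>sqrt e\<close>, which
  governs the evolution in the time \<open>\<tau>\<close>.
\<close>

definition field :: "(real \<Rightarrow> real) \<Rightarrow> (real \<Rightarrow> real) \<Rightarrow> real^2 \<Rightarrow> real^2" where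
  "field p s z = pt (z $ 2 * p (energy V (z $ 1) (z $ 2)))
     (- deriv V (z $ 1) * p (energy V (z $ 1) (z $ 2)) + sqrt 3 * (z $ 2 * s (energy V (z $ 1) (z $ 2))))"

definition field' ::
  "(real \<Rightarrow> real) \<Rightarrow> (real \<Rightarrow> real) \<Rightarrow> (real \<Rightarrow> real) \<Rightarrow> (real \<Rightarrow> real) \<Rightarrow> real^2 \<Rightarrow> real^2 \<Rightarrow> real^2" where
  "field' p p' s s' z k =
     (let e = energy V (z $ 1) (z $ 2); e' = 2 * z $ 2 * k $ 2 + 2 * deriv V (z $ 1) * k $ 1
      in pt (k $ 2 * p e + z $ 2 * (p' e * e'))
            (- (deriv (deriv V) (z $ 1) * k $ 1 * p e + deriv V (z $ 1) * (p' e * e'))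
             + sqrt 3 * (k $ 2 * s e + z $ 2 * (s' e * e'))))"

lemma field_has_derivative:
  assumes p: "\<And>x. (p has_real_derivative p' x) (at x)" and s: "\<And>x. (s has_real_derivative s' x) (at x)"
  shows "(field p s has_derivative field' p p' s s' z) (at z)"
proof -
  have nth: "((\<lambda>z. z $ i) has_derivative (\<lambda>k. k $ i)) (at z)" for i :: 2
    by (rule bounded_linear_imp_has_derivative) (rule bounded_linear_vec_nth)
  note V1 = DERIV_compose_FDERIV[OF V_deriv nth[of 1]]
  note V2 = DERIV_compose_FDERIV[OF V'_deriv nth[of 1]]
  have en: "((\<lambda>z. energy V (z $ 1) (z $ 2)) has_derivative
      (\<lambda>k. 2 * z $ 2 * k $ 2 + 2 * deriv V (z $ 1) * k $ 1)) (at z)"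
    unfolding energy_def power2_eq_square
    by (rule has_derivative_eq_rhs, (rule derivative_intros nth V1)+) (auto simp: algebra_simps)
  note pe = DERIV_compose_FDERIV[OF p en] and se = DERIV_compose_FDERIV[OF s en]
  show ?thesis
    unfolding field_def[abs_def] pt_def
    by (rule has_derivative_eq_rhs, (rule derivative_intros nth V2 pe se)+)
       (auto simp: field'_def pt_def Let_def algebra_simps fun_eq_iff)
qed

lemma field'_continuous:
  assumes p: "\<And>x. (p has_real_derivative p' x) (at x)" and s: "\<And>x. (s has_real_derivative s' x) (at x)"
    and p': "continuous_on UNIV p'" and s': "continuous_on UNIV s'"
  shows "continuous_on UNIV (\<lambda>z. field' p p' s s' z k)"
proof -
  have ps: "continuous_on UNIV p" "continuous_on UNIV s"
    using p s by (meson DERIV_isCont continuous_at_imp_continuous_on)+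
  have nth: "continuous_on UNIV (\<lambda>z :: real^2. z $ i)" for i
    by (intro continuous_intros)
  have en: "continuous_on UNIV (\<lambda>z :: real^2. energy V (z $ 1) (z $ 2))"
    unfolding energy_def by (intro continuous_intros continuous_on_compose2[OF V_cont[of UNIV]]) auto
  note comp = continuous_on_compose2[OF _ en subset_UNIV]
  show ?thesis
    unfolding field'_def Let_def pt_def
    by (intro continuous_intros nth comp ps p' s' continuous_on_compose2[OF V'_cont[of UNIV] nth]
        continuous_on_compose2[OF V''_cont nth] subset_UNIV)
qed

text \<open>
  The terms with \<open>p\<close> form a Hamiltonian field, whose Hamiltonian is half of an antiderivative of \<open>p\<close>
  applied to the energy density, so their contributions to the divergence cancel.
\<close>

lemma field_divergence:
  "field' p p' (\<lambda>_. 1) (\<lambda>_. 0) z (axis 1 1) $ 1 + field' p p' (\<lambda>_. 1) (\<lambda>_. 0) z (axis 2 1) $ 2 = sqrt 3"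
  by (simp add: field'_def Let_def axis_def)

end

lemma class_V_imp_bounded_below_potential:
  assumes "class_V V"
  shows "\<exists>C. bounded_below_potential V C"
proof -
  have D1: "\<exists>D. (\<forall>x. (f has_real_derivative D x) (at x)) \<and> continuous_on UNIV D" if "f C1_differentiable_on UNIV" for f :: "real \<Rightarrow> real"
    using that unfolding C1_differentiable_on_def has_real_derivative_iff_has_vector_derivative by auto
  obtain D where D: "\<And>x. (V has_real_derivative D x) (at x)"
    using D1[of V] assms unfolding class_V_def by blast
  have d1: "deriv V = D" using D DERIV_imp_deriv by blast
  obtain D2 where D2: "\<And>x. (deriv V has_real_derivative D2 x) (at x)" "continuous_on UNIV D2"
    using D1[of "deriv V"] assms unfolding class_V_def by blast
  have d2: "deriv (deriv V) = D2" using D2(1) DERIV_imp_deriv by blast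
  obtain b where b: "\<And>x. b \<le> V x"
    using assms unfolding class_V_def bdd_below_def by auto
  have "bounded_below_potential V \<bar>b\<bar>"
  proof
    show "- \<bar>b\<bar> \<le> V x" for x using b[of x] by linarith
  qed (use D D2 d1 d2 in auto)
  then show ?thesis by blast
qed

section \<open>Extension of collapsing solutions\<close>

lemma lifespan_interval: "lifespan (ereal T) = {0..<T}"
  by (auto simp: lifespan_def)

lemma lifespan_le: "t \<in> lifespan T \<Longrightarrow> 0 \<le> s \<Longrightarrow> s \<le> t \<Longrightarrow> s \<in> lifespan T"
  unfolding lifespan_def by (auto intro: le_less_trans[rotated] simp: )

lemma at_within_lifespan:
  assumes "t \<in> lifespan T" "0 < s" "s < t"
  shows "at s within lifespan T = at s"
proof -
  have "s \<in> {0<..<t}" "{0<..<t} \<subseteq> lifespan T"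
    using assms lifespan_le by auto
  then have "s \<in> interior (lifespan T)" by (meson interiorI open_greaterThanLessThan)
  then show ?thesis by (rule at_within_interior)
qed

lemma lifespan_nonneg_deriv_mono:
  fixes f :: "real \<Rightarrow> real"
  assumes der: "\<And>t. t \<in> lifespan T \<Longrightarrow> (f has_real_derivative f' t) (at t within lifespan T)"
    and nonneg: "\<And>x. s < x \<Longrightarrow> x < t \<Longrightarrow> 0 \<le> f' x"
    and st: "0 \<le> s" "s \<le> t" "t \<in> lifespan T"
  shows "f s \<le> f t"
proof (cases "s = t")
  case False
  have "{s..t} \<subseteq> lifespan T" using st lifespan_le[of t T] by auto
  then have "continuous_on {s..t} f"
    using DERIV_continuous_on[OF der] continuous_on_subset by blast
  moreover have "(f has_real_derivative f' x) (at x)" if "s < x" "x < t" for x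
    using der[of x] at_within_lifespan[of t T x] lifespan_le[of t T x] that st by auto
  ultimately show ?thesis
    using False st nonneg DERIV_nonneg_imp_increasing_open[of s t f] by (metis order_le_less)
qed simp

context bounded_below_potential
begin

lemma energy_cont: "continuous_on S x \<Longrightarrow> continuous_on S y \<Longrightarrow> continuous_on S (\<lambda>t. energy V (x t) (y t))"
  unfolding energy_def by (intro continuous_intros continuous_on_compose2[OF V_cont[of UNIV]]) auto

text \<open>
  The square root is replaced by a function that is continuously differentiable on the whole line and
  agrees with it from half of the initial energy density on; for a short time the solution does not
  see the difference.
\<close>

lemma local_solution_exists:
  assumes e: "0 < energy V x0 y0"
  shows "\<exists>\<delta>>0. \<exists>x y. x 0 = x0 \<and> y 0 = y0 \<and> (\<forall>t\<in>{0..\<delta>}. 0 < energy V (x t) (y t) \<and>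
     (x has_real_derivative y t) (at t within {0..\<delta>}) \<and>
     (y has_real_derivative - deriv V (x t) + sqrt 3 * sqrt (energy V (x t) (y t)) * y t) (at t within {0..\<delta>}))"
proof -
  define c where "c = energy V x0 y0 / 2"
  have "0 < c" using e by (simp add: c_def)
  obtain g g' where g: "\<And>s. (g has_real_derivative g' s) (at s)" "continuous_on UNIV g'"
    and gc: "\<And>s. c \<le> s \<Longrightarrow> g s = 1 / sqrt s"
    using inverse_sqrt_C1_extension[OF \<open>0 < c\<close>] by blast
  define r where "r s = s * g s" for s
  have rc: "r s = sqrt s" if "c \<le> s" for s
    using gc[OF that] \<open>0 < c\<close> that by (simp add: r_def real_div_sqrt)
  have r: "(r has_real_derivative (g s + s * g' s)) (at s)" for s
    unfolding r_def[abs_def] by (auto intro!: derivative_eq_intros g)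
  have r': "continuous_on UNIV (\<lambda>s. g s + s * g' s)"
    using g DERIV_isCont continuous_at_imp_continuous_on by (intro continuous_intros) blast+
  define F where "F = field (\<lambda>_. 1) r"
  define F' where "F' = field' (\<lambda>_. 1) (\<lambda>_. 0) r (\<lambda>s. g s + s * g' s)"
  have "(F has_derivative F' z) (at z)" for z
    unfolding F_def F'_def by (intro field_has_derivative r) auto
  moreover have "continuous_on UNIV (\<lambda>z. F' z k)" for k
    unfolding F'_def by (intro field'_continuous r r') auto
  ultimately obtain L where "0 \<le> L"
    "\<And>a b. a \<in> cball (pt x0 y0) 1 \<Longrightarrow> b \<in> cball (pt x0 y0) 1 \<Longrightarrow> norm (F a - F b) \<le> L * norm (a - b)"
    using C1_imp_lipschitz_on_cball[of F F' "pt x0 y0" 1] by blast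
  from ode_local_existence[OF this(2,1)] obtain \<delta> z where "0 < \<delta>" and z0: "z 0 = pt x0 y0"
    and z: "\<And>t. t \<in> {0..\<delta>} \<Longrightarrow> (z has_vector_derivative F (z t)) (at t within {0..\<delta>})" by blast
  define x y where "x t = z t $ 1" and "y t = z t $ 2" for t
  have comp: "((\<lambda>t. z t $ i) has_real_derivative F (z t) $ i) (at t within {0..\<delta>})" if "t \<in> {0..\<delta>}" for t i
    using bounded_linear.has_vector_derivative[OF bounded_linear_vec_nth z[OF that], of i]
    by (simp add: has_real_derivative_iff_has_vector_derivative)
  have xy_eq: "x = (\<lambda>t. z t $ 1)" "y = (\<lambda>t. z t $ 2)" by (auto simp: x_def y_def)
  have F1: "F (z t) $ 1 = y t"
    and F2: "F (z t) $ 2 = - deriv V (x t) + sqrt 3 * (y t * r (energy V (x t) (y t)))" for t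
    by (simp_all add: F_def field_def x_def y_def)
  have dx: "(x has_real_derivative y t) (at t within {0..\<delta>})" if "t \<in> {0..\<delta>}" for t
    using comp[OF that, of 1] unfolding F1 xy_eq(1)[symmetric] .
  have dy: "(y has_real_derivative - deriv V (x t) + sqrt 3 * (y t * r (energy V (x t) (y t)))) (at t within {0..\<delta>})"
    if "t \<in> {0..\<delta>}" for t
    using comp[OF that, of 2] unfolding F2 xy_eq(2)[symmetric] .
  have cont: "continuous_on {0..\<delta>} x" "continuous_on {0..\<delta>} y"
    using DERIV_continuous_on[OF dx] DERIV_continuous_on[OF dy] by blast+
  have xy0: "x 0 = x0" "y 0 = y0" by (simp_all add: x_def y_def z0)
  have "continuous_on {0..\<delta>} (\<lambda>t. energy V (x t) (y t))" by (intro energy_cont cont)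
  then have "\<forall>e>0. \<exists>d>0. \<forall>t\<in>{0..\<delta>}. dist t 0 < d \<longrightarrow> dist (energy V (x t) (y t)) (energy V (x 0) (y 0)) < e"
    using \<open>0 < \<delta>\<close> unfolding continuous_on_iff by (metis atLeastAtMost_iff order_refl less_imp_le)
  then obtain d where "0 < d"
    and d': "\<And>t. t \<in> {0..\<delta>} \<Longrightarrow> dist t 0 < d \<Longrightarrow> dist (energy V (x t) (y t)) (energy V (x 0) (y 0)) < c"
    using \<open>0 < c\<close> by blast
  have d: "c < energy V (x t) (y t)" if "t \<in> {0..\<delta>}" "t < d" for t
  proof -
    have "\<bar>energy V (x t) (y t) - energy V x0 y0\<bar> < c"
      using d'[of t] that xy0 by (simp add: dist_real_def)
    then show ?thesis unfolding c_def by linarith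
  qed
  define \<eta> where "\<eta> = min \<delta> (d / 2)"
  have \<eta>: "0 < \<eta>" "{0..\<eta>} \<subseteq> {0..\<delta>}" using \<open>0 < \<delta>\<close> \<open>0 < d\<close> by (auto simp: \<eta>_def)
  have lower: "c < energy V (x t) (y t)" if "t \<in> {0..\<eta>}" for t
    using d[of t] that \<open>0 < d\<close> by (auto simp: \<eta>_def)
  have "0 < energy V (x t) (y t) \<and>
     (x has_real_derivative y t) (at t within {0..\<eta>}) \<and>
     (y has_real_derivative - deriv V (x t) + sqrt 3 * sqrt (energy V (x t) (y t)) * y t) (at t within {0..\<eta>})" if t: "t \<in> {0..\<eta>}" for t
  proof (intro conjI)
    have t\<delta>: "t \<in> {0..\<delta>}" using t \<eta>(2) by blast
    show "0 < energy V (x t) (y t)" using lower[OF t] \<open>0 < c\<close> by simp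
    show "(x has_real_derivative y t) (at t within {0..\<eta>})"
      by (rule DERIV_subset[OF dx[OF t\<delta>] \<eta>(2)])
    show "(y has_real_derivative - deriv V (x t) + sqrt 3 * sqrt (energy V (x t) (y t)) * y t) (at t within {0..\<eta>})"
      using DERIV_subset[OF dy[OF t\<delta>] \<eta>(2)] rc[of "energy V (x t) (y t)"] lower[OF t] by (simp add: mult_ac)
  qed
  then show ?thesis using \<eta>(1) xy0 by blast
qed

text \<open>
  If the energy density is bounded, so are \<open>v\<close>, hence \<open>\<phi>\<close>, and hence the derivative of \<open>v\<close>. Both
  functions therefore have limits at \<open>T\<close>, where a new solution starts. The scale factor is recovered
  by integrating its logarithmic derivative over the whole extended interval.
\<close>

lemma collapsing_solution_extends:
  assumes sol: "collapsing_solution V (ereal T) a \<phi> v"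
    and "0 < e0" and lower: "\<And>t. t \<in> {0..<T} \<Longrightarrow> e0 \<le> energy V (\<phi> t) (v t)"
    and upper: "\<And>t. t \<in> {0..<T} \<Longrightarrow> energy V (\<phi> t) (v t) \<le> E"
  shows "\<exists>T' b \<psi> w. ereal T < T' \<and> collapsing_solution V T' b \<psi> w \<and>
           (\<forall>t\<in>lifespan (ereal T). b t = a t \<and> \<psi> t = \<phi> t \<and> w t = v t)"
proof -
  define \<epsilon> where "\<epsilon> t = energy V (\<phi> t) (v t)" for t
  have "0 < T" using sol unfolding collapsing_solution_def by simp
  have solD: "0 < a t"
      "\<exists>a'. (a has_real_derivative a') (at t within {0..<T}) \<and> a' / a t = - sqrt (\<epsilon> t / 3)"
      "(\<phi> has_real_derivative v t) (at t within {0..<T})"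
      "\<exists>v'. (v has_real_derivative v') (at t within {0..<T}) \<and> v' + deriv V (\<phi> t) = sqrt 3 * sqrt (\<epsilon> t) * v t"
    if "t \<in> {0..<T}" for t
    using sol that unfolding collapsing_solution_def lifespan_interval \<epsilon>_def by blast+
  have dphi: "(\<phi> has_real_derivative v t) (at t within {0..<T})" if "t \<in> {0..<T}" for t
    using solD(3) that .
  have dv: "(v has_real_derivative - deriv V (\<phi> t) + sqrt 3 * sqrt (\<epsilon> t) * v t) (at t within {0..<T})"
    if "t \<in> {0..<T}" for t
    using solD(4)[OF that] by (metis add.commute add_diff_cancel_right' diff_conv_add_uminus)
  have da: "(a has_real_derivative - sqrt (\<epsilon> t / 3) * a t) (at t within {0..<T})" if "t \<in> {0..<T}" for t
    using solD(1,2)[OF that] by (metis less_irrefl nonzero_eq_divide_eq)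
  define K where "K = sqrt (E + 2 * C)"
  have vK: "\<bar>v t\<bar> \<le> K" if "t \<in> {0..<T}" for t
  proof -
    have "(v t)\<^sup>2 \<le> E + 2 * C" using upper[OF that] V_ge[of "\<phi> t"] by (simp add: energy_def)
    then show ?thesis unfolding K_def using real_sqrt_le_mono by fastforce
  qed
  obtain \<phi>1 where c\<phi>: "continuous_on {0..T} \<phi>1" and \<phi>1: "\<And>t. t \<in> {0..<T} \<Longrightarrow> \<phi>1 t = \<phi> t"
    using bounded_derivative_continuous_extension[OF \<open>0 < T\<close> dphi vK] by blast
  have "bounded ((\<lambda>t. deriv V (\<phi>1 t)) ` {0..T})"
    by (intro compact_imp_bounded compact_continuous_image continuous_on_compose2[OF V'_cont[of UNIV] c\<phi>]) auto
  then obtain B where B: "\<And>t. t \<in> {0..T} \<Longrightarrow> \<bar>deriv V (\<phi>1 t)\<bar> \<le> B"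
    unfolding bounded_iff real_norm_def by blast
  have v'bound: "\<bar>- deriv V (\<phi> t) + sqrt 3 * sqrt (\<epsilon> t) * v t\<bar> \<le> B + sqrt 3 * sqrt E * K" if t: "t \<in> {0..<T}" for t
  proof -
    have "\<bar>sqrt 3 * sqrt (\<epsilon> t) * v t\<bar> = sqrt 3 * sqrt (\<epsilon> t) * \<bar>v t\<bar>"
      using lower[OF t] \<open>0 < e0\<close> by (simp add: abs_mult \<epsilon>_def)
    also have "\<dots> \<le> sqrt 3 * sqrt E * K"
      using lower[OF t] \<open>0 < e0\<close> upper[OF t] vK[OF t] by (intro mult_mono) (auto simp: \<epsilon>_def)
    finally show ?thesis using B[of t] \<phi>1[OF t] t by auto
  qed
  obtain v1 where cv: "continuous_on {0..T} v1" and v1: "\<And>t. t \<in> {0..<T} \<Longrightarrow> v1 t = v t"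
    using bounded_derivative_continuous_extension[OF \<open>0 < T\<close> dv v'bound] by blast
  have ce: "continuous_on {0..T} (\<lambda>t. energy V (\<phi>1 t) (v1 t))" by (intro energy_cont c\<phi> cv)
  have "e0 \<le> energy V (\<phi>1 T) (v1 T)"
  proof (rule continuous_ge_on_closure[of "{0..<T}" "\<lambda>t. energy V (\<phi>1 t) (v1 t)"])
    show "continuous_on (closure {0..<T}) (\<lambda>t. energy V (\<phi>1 t) (v1 t))" "T \<in> closure {0..<T}"
      using ce \<open>0 < T\<close> by auto
    show "\<And>x. x \<in> {0..<T} \<Longrightarrow> e0 \<le> energy V (\<phi>1 x) (v1 x)" using lower \<phi>1 v1 by simp
  qed
  then have "0 < energy V (\<phi>1 T) (v1 T)" using \<open>0 < e0\<close> by simp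
  from local_solution_exists[OF this] obtain \<delta> x y where "0 < \<delta>" and xy0: "x 0 = \<phi>1 T" "y 0 = v1 T"
    and exy: "\<And>t. t \<in> {0..\<delta>} \<Longrightarrow> 0 < energy V (x t) (y t)"
    and dx: "\<And>t. t \<in> {0..\<delta>} \<Longrightarrow> (x has_real_derivative y t) (at t within {0..\<delta>})"
    and dy: "\<And>t. t \<in> {0..\<delta>} \<Longrightarrow>
       (y has_real_derivative - deriv V (x t) + sqrt 3 * sqrt (energy V (x t) (y t)) * y t) (at t within {0..\<delta>})"
    by blast
  define \<psi> where "\<psi> t = (if t \<le> T then \<phi>1 t else x (t - T))" for t
  define w where "w t = (if t \<le> T then v1 t else y (t - T))" for t
  define S where "S = T + \<delta>"
  have cx: "continuous_on {0..\<delta>} x" "continuous_on {0..\<delta>} y"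
    using DERIV_continuous_on[OF dx] DERIV_continuous_on[OF dy] by blast+
  have glue: "continuous_on {0..S} (\<lambda>t. if t \<le> T then f t else h (t - T))"
    if "continuous_on {0..T} f" "continuous_on {0..\<delta>} h" "h 0 = f T" for f h :: "real \<Rightarrow> real"
  proof -
    have "continuous_on ({0..T} \<union> {T..S}) (\<lambda>t. if t \<le> T then f t else h (t - T))"
      using that \<open>0 < T\<close> \<open>0 < \<delta>\<close>
      by (intro continuous_on_If continuous_on_compose2[OF that(2), of _ "\<lambda>t. t - T"] continuous_intros)
         (auto simp: S_def)
    moreover have "{0..T} \<union> {T..S} = {0..S}" using \<open>0 < T\<close> \<open>0 < \<delta>\<close> by (auto simp: S_def)
    ultimately show ?thesis by simp
  qed
  have cpsi: "continuous_on {0..S} \<psi>" and cw: "continuous_on {0..S} w"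
    unfolding \<psi>_def[abs_def] w_def[abs_def] using glue c\<phi> cv cx xy0 by auto
  have cE: "continuous_on {0..S} (\<lambda>t. energy V (\<psi> t) (w t))" by (intro energy_cont cpsi cw)
  have epos: "0 < energy V (\<psi> t) (w t)" if "t \<in> {0..S}" for t
  proof -
    consider "t < T" | "t = T" | "T < t" by linarith
    then show ?thesis
    proof cases
      case 1 then show ?thesis using that lower[of t] \<open>0 < e0\<close> \<phi>1[of t] v1[of t] by (auto simp: \<psi>_def w_def)
    next
      case 2 then show ?thesis using \<open>0 < energy V (\<phi>1 T) (v1 T)\<close> by (simp add: \<psi>_def w_def)
    next
      case 3 then show ?thesis using that exy[of "t - T"] by (auto simp: \<psi>_def w_def S_def)
    qed
  qed
  define w' where "w' t = - deriv V (\<psi> t) + sqrt 3 * sqrt (energy V (\<psi> t) (w t)) * w t" for t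
  have cw': "continuous_on {0..S} w'"
    unfolding w'_def by (intro continuous_intros cw cE continuous_on_compose2[OF V'_cont[of UNIV] cpsi]) auto
  have off: "(\<psi> has_real_derivative w t) (at t) \<and> (w has_real_derivative w' t) (at t)"
    if t: "t \<in> {0<..<S} - {T}" for t
  proof (cases "t < T")
    case True
    then have "at t within {0..<T} = at t" using t by (intro at_within_interior) auto
    then have "(\<phi> has_real_derivative w t) (at t)" "(v has_real_derivative w' t) (at t)"
      using dphi[of t] dv[of t] t True \<phi>1[of t] v1[of t] by (auto simp: w_def w'_def \<psi>_def \<epsilon>_def)
    moreover have "\<And>s. s \<in> {0<..<T} \<Longrightarrow> \<phi> s = \<psi> s" "\<And>s. s \<in> {0<..<T} \<Longrightarrow> v s = w s"
      using \<phi>1 v1 by (auto simp: \<psi>_def w_def)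
    ultimately show ?thesis
      using True t by (auto intro: has_field_derivative_transform_within_open[of _ _ _ "{0<..<T}"])
  next
    case False
    with t have t': "T < t" "t - T \<in> {0<..<\<delta>}" by (auto simp: S_def)
    then have "at (t - T) within {0..\<delta>} = at (t - T)" by (intro at_within_interior) auto
    then have "(x has_real_derivative w t) (at (t - T))" "(y has_real_derivative w' t) (at (t - T))"
      using dx[of "t - T"] dy[of "t - T"] t' by (auto simp: w_def w'_def \<psi>_def)
    then have "((\<lambda>s. x (s - T)) has_real_derivative w t) (at t)" "((\<lambda>s. y (s - T)) has_real_derivative w' t) (at t)"
      using DERIV_shift[of x _ t "- T"] DERIV_shift[of y _ t "- T"] by auto
    moreover have "\<And>s. s \<in> {T<..} \<Longrightarrow> x (s - T) = \<psi> s" "\<And>s. s \<in> {T<..} \<Longrightarrow> y (s - T) = w s"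
      by (auto simp: \<psi>_def w_def)
    ultimately show ?thesis
      using t' by (auto intro: has_field_derivative_transform_within_open[of _ _ _ "{T<..}"])
  qed
  have dpsi: "(\<psi> has_real_derivative w t) (at t within {0..S})"
    and dw: "(w has_real_derivative w' t) (at t within {0..S})" if "t \<in> {0..S}" for t
  proof -
    have "(\<psi> has_vector_derivative w s) (at s)" "(w has_vector_derivative w' s) (at s)"
      if "s \<in> {0<..<S} - {T}" for s
      using off[OF that] by (auto simp: has_real_derivative_iff_has_vector_derivative)
    then have "(\<psi> has_vector_derivative w t) (at t within {0..S})"
      "(w has_vector_derivative w' t) (at t within {0..S})"
      using that by (blast intro: has_vector_derivative_across_point[OF cpsi cw]
          has_vector_derivative_across_point[OF cw cw'])+
    then show "(\<psi> has_real_derivative w t) (at t within {0..S})"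
      "(w has_real_derivative w' t) (at t within {0..S})"
      by (auto simp: has_real_derivative_iff_has_vector_derivative)
  qed
  define \<rho> where "\<rho> t = - sqrt (energy V (\<psi> t) (w t) / 3)" for t
  have c\<rho>: "continuous_on {0..S} \<rho>" unfolding \<rho>_def by (intro continuous_intros cE) auto
  define b where "b t = a 0 * exp (integral {0..t} \<rho>)" for t
  have "0 < a 0" using solD(1)[of 0] \<open>0 < T\<close> by simp
  then have bpos: "0 < b t" for t by (simp add: b_def)
  have db: "(b has_real_derivative b t * \<rho> t) (at t within {0..S})" if "t \<in> {0..S}" for t
    unfolding b_def[abs_def]
    using integral_has_real_derivative[OF c\<rho> that]
    by (auto intro!: derivative_eq_intros)
  have agree: "b t = a t \<and> \<psi> t = \<phi> t \<and> w t = v t" if t: "t \<in> {0..<T}" for t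
  proof (intro conjI)
    show "\<psi> t = \<phi> t" "w t = v t" using t \<phi>1 v1 by (auto simp: \<psi>_def w_def)
    have \<rho>t: "\<rho> s = - sqrt (\<epsilon> s / 3)" if "s \<in> {0..<T}" for s
      using that \<phi>1 v1 by (auto simp: \<rho>_def \<epsilon>_def \<psi>_def w_def)
    have "((\<lambda>s. ln (a s)) has_vector_derivative \<rho> s) (at s within {0..t})" if "s \<in> {0..t}" for s
    proof -
      have "s \<in> {0..<T}" using that t by auto
      from da[OF this] solD(1)[OF this] \<rho>t[OF this]
      have "((\<lambda>s. ln (a s)) has_real_derivative \<rho> s) (at s within {0..<T})"
        by (auto intro!: derivative_eq_intros)
      then show ?thesis
        unfolding has_real_derivative_iff_has_vector_derivative[symmetric]
        by (rule DERIV_subset) (use t in auto)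
    qed
    then have "(\<rho> has_integral (ln (a t) - ln (a 0))) {0..t}"
      using t by (intro fundamental_theorem_of_calculus) auto
    then show "b t = a t"
      using solD(1)[OF t] \<open>0 < a 0\<close> by (simp add: b_def integral_unique exp_diff)
  qed
  have "collapsing_solution V (ereal S) b \<psi> w"
    unfolding collapsing_solution_def lifespan_interval
  proof (intro conjI ballI impI)
    show "0 < ereal S" using \<open>0 < T\<close> \<open>0 < \<delta>\<close> by (simp add: S_def)
    fix t assume "t \<in> {0..<S}"
    then have t: "t \<in> {0..S}" and sub: "{0..<S} \<subseteq> {0..S}" by auto
    show "0 < b t" by (rule bpos)
    show "0 \<le> energy V (\<psi> t) (w t)" "0 < energy V (\<psi> t) (w t)" using epos[OF t] by auto
    show "\<exists>a'. (b has_real_derivative a') (at t within {0..<S}) \<and> a' / b t = - sqrt (energy V (\<psi> t) (w t) / 3)"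
      using DERIV_subset[OF db[OF t] sub] bpos[of t] by (intro exI[of _ "b t * \<rho> t"]) (auto simp: \<rho>_def)
    show "(\<psi> has_real_derivative w t) (at t within {0..<S})"
      using DERIV_subset[OF dpsi[OF t] sub] .
    show "\<exists>v'. (w has_real_derivative v') (at t within {0..<S}) \<and>
        v' + deriv V (\<psi> t) = sqrt 3 * sqrt (energy V (\<psi> t) (w t)) * w t"
      using DERIV_subset[OF dw[OF t] sub] by (intro exI[of _ "w' t"]) (auto simp: w'_def)
  qed
  moreover have "ereal T < ereal S" using \<open>0 < \<delta>\<close> by (simp add: S_def)
  ultimately show ?thesis using agree unfolding lifespan_interval by blast
qed

end

section \<open>Evolution in logarithmic time\<close>

text \<open>
  The time whose rate is the square root of the energy density; it is called \<open>\<tau>\<close> below.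
\<close>

definition log_contraction :: "(real \<Rightarrow> real) \<Rightarrow> real \<Rightarrow> real" where
  "log_contraction a t = - sqrt 3 * ln (a t / a 0)"

text \<open>
  The constant \<open>e0\<close> is kept apart from the initial energy density, so that the estimates are uniform
  over sets of initial data.
\<close>

locale collapse = bounded_below_potential +
  fixes T :: ereal and a \<phi> v :: "real \<Rightarrow> real" and e0 :: real
  assumes sol: "collapsing_solution V T a \<phi> v"
    and e0_pos: "0 < e0" and e0_le: "e0 \<le> energy V (\<phi> 0) (v 0)"
begin

abbreviation \<epsilon> where "\<epsilon> t \<equiv> energy V (\<phi> t) (v t)"

abbreviation \<tau> where "\<tau> \<equiv> log_contraction a"

lemma zero_in_lifespan: "0 \<in> lifespan T"
  using sol unfolding collapsing_solution_def lifespan_def by (simp add: zero_ereal_def)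

lemma a_pos: "t \<in> lifespan T \<Longrightarrow> 0 < a t"
  using sol unfolding collapsing_solution_def by blast

lemma a_deriv:
  assumes "t \<in> lifespan T"
  shows "(a has_real_derivative - sqrt (\<epsilon> t / 3) * a t) (at t within lifespan T)"
proof -
  obtain a' where "(a has_real_derivative a') (at t within lifespan T)" "a' / a t = - sqrt (\<epsilon> t / 3)"
    using sol assms unfolding collapsing_solution_def by blast
  moreover from this have "a' = - sqrt (\<epsilon> t / 3) * a t"
    using a_pos[OF assms] by (simp add: divide_eq_eq)
  ultimately show ?thesis by simp
qed

lemma phi_deriv: "t \<in> lifespan T \<Longrightarrow> (\<phi> has_real_derivative v t) (at t within lifespan T)"
  using sol unfolding collapsing_solution_def by blast

lemma v_deriv:
  assumes "t \<in> lifespan T"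
  shows "(v has_real_derivative - deriv V (\<phi> t) + sqrt 3 * sqrt (\<epsilon> t) * v t) (at t within lifespan T)"
proof -
  obtain v' where "(v has_real_derivative v') (at t within lifespan T)"
    "v' + deriv V (\<phi> t) = sqrt 3 * sqrt (\<epsilon> t) * v t"
    using sol assms unfolding collapsing_solution_def by blast
  moreover from this have "v' = - deriv V (\<phi> t) + sqrt 3 * sqrt (\<epsilon> t) * v t" by linarith
  ultimately show ?thesis by simp
qed

lemma energy_deriv:
  assumes t: "t \<in> lifespan T"
  shows "(\<epsilon> has_real_derivative 2 * sqrt 3 * sqrt (\<epsilon> t) * (v t)\<^sup>2) (at t within lifespan T)"
proof -
  have "((\<lambda>t. V (\<phi> t)) has_real_derivative deriv V (\<phi> t) * v t) (at t within lifespan T)"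
    by (rule DERIV_chain2[OF V_deriv phi_deriv[OF t]])
  then show ?thesis
    unfolding energy_def[of V "\<phi> _" "v _"]
    by (auto intro!: derivative_eq_intros v_deriv[OF t] simp: energy_def algebra_simps power2_eq_square)
qed

lemma energy_nonneg: "t \<in> lifespan T \<Longrightarrow> 0 \<le> \<epsilon> t"
  using sol unfolding collapsing_solution_def by blast

lemma energy_mono:
  assumes "0 \<le> s" "s \<le> t" "t \<in> lifespan T"
  shows "\<epsilon> s \<le> \<epsilon> t"
  using assms energy_nonneg lifespan_le
  by (intro lifespan_nonneg_deriv_mono[OF energy_deriv]) auto

lemma energy_ge: "t \<in> lifespan T \<Longrightarrow> e0 \<le> \<epsilon> t"
  using energy_mono[of 0 t] e0_le unfolding lifespan_def by auto

lemma v_sq_le: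
  assumes t: "t \<in> lifespan T"
  shows "(v t)\<^sup>2 \<le> (1 + 2 * C / e0) * \<epsilon> t"
proof -
  have "C * e0 \<le> C * \<epsilon> t" using energy_ge[OF t] C_nonneg by (rule mult_left_mono)
  then have "C \<le> C / e0 * \<epsilon> t" using e0_pos by (simp add: field_simps)
  moreover have "(v t)\<^sup>2 \<le> \<epsilon> t + 2 * C" using V_ge[of "\<phi> t"] by (simp add: energy_def)
  ultimately have "(v t)\<^sup>2 \<le> \<epsilon> t + 2 * (C / e0 * \<epsilon> t)" by linarith
  then show ?thesis by (simp only: distrib_right mult_1 times_divide_eq_right mult.assoc)
qed

lemma tau_deriv:
  assumes t: "t \<in> lifespan T"
  shows "(\<tau> has_real_derivative sqrt (\<epsilon> t)) (at t within lifespan T)"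
proof -
  have pos: "0 < a t" "0 < a 0" using a_pos t zero_in_lifespan by auto
  have "((\<lambda>t. a t / a 0) has_real_derivative - sqrt (\<epsilon> t / 3) * a t / a 0) (at t within lifespan T)"
    by (rule DERIV_cdivide[OF a_deriv[OF t]])
  then have "((\<lambda>t. ln (a t / a 0)) has_real_derivative
      1 / (a t / a 0) * (- sqrt (\<epsilon> t / 3) * a t / a 0)) (at t within lifespan T)"
    using pos by (intro DERIV_chain2[OF DERIV_ln_divide]) auto
  then have "((\<lambda>t. ln (a t / a 0)) has_real_derivative - sqrt (\<epsilon> t / 3)) (at t within lifespan T)"
    using pos by simp
  then have "((\<lambda>t. - sqrt 3 * ln (a t / a 0)) has_real_derivative - sqrt 3 * - sqrt (\<epsilon> t / 3)) (at t within lifespan T)"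
    by (rule DERIV_cmult)
  moreover have "- sqrt 3 * - sqrt (\<epsilon> t / 3) = sqrt (\<epsilon> t)"
    by (simp flip: real_sqrt_mult)
  ultimately show ?thesis unfolding log_contraction_def[abs_def] by simp
qed

lemma tau_0 [simp]: "\<tau> 0 = 0"
  using a_pos[OF zero_in_lifespan] by (simp add: log_contraction_def)

lemma a_eq: "t \<in> lifespan T \<Longrightarrow> a t = a 0 * exp (- \<tau> t / sqrt 3)"
  using a_pos[of t] a_pos[OF zero_in_lifespan] by (simp add: log_contraction_def)

lemma tau_diff_ge:
  assumes "0 \<le> s" "s \<le> t" "t \<in> lifespan T"
  shows "sqrt e0 * (t - s) \<le> \<tau> t - \<tau> s"
proof -
  have "\<tau> s - sqrt e0 * s \<le> \<tau> t - sqrt e0 * t"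
  proof (rule lifespan_nonneg_deriv_mono[OF _ _ assms])
    show "((\<lambda>t. \<tau> t - sqrt e0 * t) has_real_derivative sqrt (\<epsilon> r) - sqrt e0 * 1) (at r within lifespan T)"
      if "r \<in> lifespan T" for r
      by (intro DERIV_diff tau_deriv that DERIV_cmult DERIV_ident)
    show "0 \<le> sqrt (\<epsilon> r) - sqrt e0 * 1" if "s < r" "r < t" for r
      using energy_ge[of r] lifespan_le[OF assms(3), of r] that assms(1) by auto
  qed
  then show ?thesis by (simp add: algebra_simps)
qed

lemma tau_strict_mono:
  assumes "0 \<le> s" "s < t" "t \<in> lifespan T"
  shows "\<tau> s < \<tau> t"
proof -
  have "0 < sqrt e0 * (t - s)" using assms e0_pos by simp
  then show ?thesis using tau_diff_ge[of s t] assms by simp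
qed

lemma tau_ge: "t \<in> lifespan T \<Longrightarrow> sqrt e0 * t \<le> \<tau> t"
  using tau_diff_ge[of 0 t] by (auto simp: lifespan_def)

lemma tau_mono:
  assumes "0 \<le> s" "s \<le> t" "t \<in> lifespan T"
  shows "\<tau> s \<le> \<tau> t"
  using tau_strict_mono[of s t] assms by (cases "s = t") auto

text \<open>
  Compare \<open>d\<epsilon>/d\<tau> = 2 \<surd>3 v\<^sup>2\<close> with the bound of \<open>v\<^sup>2\<close> by a multiple of \<open>\<epsilon>\<close>. In particular, the energy
  density can only become unbounded if \<open>\<tau>\<close> does.
\<close>

lemma energy_le_exp_tau:
  assumes t: "t \<in> lifespan T"
  shows "\<epsilon> t \<le> \<epsilon> 0 * exp (2 * sqrt 3 * (1 + 2 * C / e0) * \<tau> t)"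
proof -
  define k where "k = 2 * sqrt 3 * (1 + 2 * C / e0)"
  have pos: "0 < \<epsilon> s" if "s \<in> lifespan T" for s using energy_ge[OF that] e0_pos by simp
  have "k * \<tau> 0 - ln (\<epsilon> 0) \<le> k * \<tau> t - ln (\<epsilon> t)"
  proof (rule lifespan_nonneg_deriv_mono[where T = T and f = "\<lambda>s. k * \<tau> s - ln (\<epsilon> s)"])
    show "((\<lambda>s. k * \<tau> s - ln (\<epsilon> s)) has_real_derivative
        k * sqrt (\<epsilon> s) - (2 * sqrt 3 * sqrt (\<epsilon> s) * (v s)\<^sup>2) / \<epsilon> s) (at s within lifespan T)"
      if "s \<in> lifespan T" for s
      using pos[OF that]
      by (auto intro!: derivative_eq_intros tau_deriv[OF that] energy_deriv[OF that])
    fix s assume "0 < s" "s < t"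
    then have s: "s \<in> lifespan T" using lifespan_le[OF t] by auto
    have "2 * sqrt 3 * sqrt (\<epsilon> s) * (v s)\<^sup>2 \<le> 2 * sqrt 3 * sqrt (\<epsilon> s) * ((1 + 2 * C / e0) * \<epsilon> s)"
      using v_sq_le[OF s] pos[OF s] by (intro mult_left_mono) auto
    also have "\<dots> = k * sqrt (\<epsilon> s) * \<epsilon> s" by (simp add: k_def)
    finally show "0 \<le> k * sqrt (\<epsilon> s) - (2 * sqrt 3 * sqrt (\<epsilon> s) * (v s)\<^sup>2) / \<epsilon> s"
      using pos[OF s] by (simp add: divide_le_eq)
  qed (use t lifespan_def in auto)
  then have "ln (\<epsilon> t) \<le> ln (\<epsilon> 0) + k * \<tau> t" by simp
  then have "exp (ln (\<epsilon> t)) \<le> exp (ln (\<epsilon> 0) + k * \<tau> t)" by (rule exp_le_cancel_iff[THEN iffD2])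
  then show ?thesis using pos[OF t] pos[OF zero_in_lifespan] by (simp add: exp_add k_def)
qed

text \<open>
  This is the estimate \<open>\<bar>d\<phi>/d\<tau>\<bar> = \<bar>v\<bar>/\<surd>\<epsilon> \<le> K\<close>, integrated. It is applied twice: with the constant
  from \<open>v_sq_le\<close>, and at late times with \<open>K = 1 + \<eta>\<close>.
\<close>

lemma phi_diff_le:
  assumes "0 \<le> s" "s \<le> t" "t \<in> lifespan T" "0 \<le> K"
    and K: "\<And>r. s < r \<Longrightarrow> r < t \<Longrightarrow> (v r)\<^sup>2 \<le> K\<^sup>2 * \<epsilon> r"
  shows "\<bar>\<phi> t - \<phi> s\<bar> \<le> K * (\<tau> t - \<tau> s)"
proof -
  have vK: "\<bar>v r\<bar> \<le> K * sqrt (\<epsilon> r)" if "s < r" "r < t" for r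
  proof -
    have "sqrt ((v r)\<^sup>2) \<le> sqrt (K\<^sup>2 * \<epsilon> r)" using K[OF that] by (rule real_sqrt_le_mono)
    then show ?thesis using \<open>0 \<le> K\<close> by (simp add: real_sqrt_mult)
  qed
  have "K * \<tau> s - \<phi> s \<le> K * \<tau> t - \<phi> t"
  proof (rule lifespan_nonneg_deriv_mono[OF _ _ assms(1-3)])
    show "((\<lambda>t. K * \<tau> t - \<phi> t) has_real_derivative K * sqrt (\<epsilon> r) - v r) (at r within lifespan T)"
      if "r \<in> lifespan T" for r
      by (intro DERIV_diff tau_deriv phi_deriv that DERIV_cmult)
    show "0 \<le> K * sqrt (\<epsilon> r) - v r" if "s < r" "r < t" for r using vK[OF that] by linarith
  qed
  moreover have "K * \<tau> s + \<phi> s \<le> K * \<tau> t + \<phi> t"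
  proof (rule lifespan_nonneg_deriv_mono[OF _ _ assms(1-3)])
    show "((\<lambda>t. K * \<tau> t + \<phi> t) has_real_derivative K * sqrt (\<epsilon> r) + v r) (at r within lifespan T)"
      if "r \<in> lifespan T" for r
      by (intro DERIV_add tau_deriv phi_deriv that DERIV_cmult)
    show "0 \<le> K * sqrt (\<epsilon> r) + v r" if "s < r" "r < t" for r using vK[OF that] by linarith
  qed
  ultimately show ?thesis by (auto simp: algebra_simps abs_le_iff)
qed

text \<open>
  Since \<open>d\<tau>/dt\<close> is bounded below, a bounded \<open>\<tau>\<close> forces \<open>T\<close> to be finite; the energy density is then
  bounded as well, and the solution extends beyond \<open>T\<close>.
\<close>

lemma maximal_imp_tau_unbounded:
  assumes "maximal_collapsing_solution V T a \<phi> v"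
  shows "\<exists>t\<in>lifespan T. n \<le> \<tau> t"
proof (rule ccontr)
  assume "\<not> (\<exists>t\<in>lifespan T. n \<le> \<tau> t)"
  then have n: "\<tau> t \<le> n" if "t \<in> lifespan T" for t using that by force
  have "T \<noteq> \<infinity>"
  proof
    assume "T = \<infinity>"
    then have "\<bar>n\<bar> / sqrt e0 + 1 \<in> lifespan T" using e0_pos by (simp add: lifespan_def)
    from n[OF this] tau_ge[OF this] have "sqrt e0 * (\<bar>n\<bar> / sqrt e0 + 1) \<le> n" by linarith
    moreover have "sqrt e0 * (\<bar>n\<bar> / sqrt e0 + 1) = \<bar>n\<bar> + sqrt e0"
      using e0_pos by (simp add: distrib_left)
    ultimately show False using real_sqrt_gt_zero[OF e0_pos] by linarith
  qed
  moreover have "0 < T" using sol unfolding collapsing_solution_def by blast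
  ultimately obtain T0 where T: "T = ereal T0" by (cases T) auto
  have "\<epsilon> t \<le> \<epsilon> 0 * exp (2 * sqrt 3 * (1 + 2 * C / e0) * n)" if "t \<in> lifespan T" for t
  proof -
    have "exp (2 * sqrt 3 * (1 + 2 * C / e0) * \<tau> t) \<le> exp (2 * sqrt 3 * (1 + 2 * C / e0) * n)"
      using n[OF that] C_nonneg e0_pos by (intro exp_le_cancel_iff[THEN iffD2] mult_left_mono) auto
    then show ?thesis
      using energy_le_exp_tau[OF that] energy_nonneg[OF zero_in_lifespan]
      by (meson mult_left_mono order_trans)
  qed
  then have "\<exists>T' b \<psi> w. ereal T0 < T' \<and> collapsing_solution V T' b \<psi> w \<and>
           (\<forall>t\<in>lifespan (ereal T0). b t = a t \<and> \<psi> t = \<phi> t \<and> w t = v t)"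
    using energy_ge
    by (intro collapsing_solution_extends[OF sol[unfolded T] e0_pos]) (auto simp: T lifespan_interval)
  then show False using assms unfolding maximal_collapsing_solution_def T by blast
qed

lemma tau_cont: "S \<subseteq> lifespan T \<Longrightarrow> continuous_on S \<tau>"
  using DERIV_continuous_on[OF tau_deriv] continuous_on_subset by blast

text \<open>
  The inverse \<open>\<sigma>\<close> of \<open>\<tau>\<close> transports the solution to the time \<open>\<tau>\<close>. The function \<open>g\<close> may be any
  extension of the inverse square root, because the energy density never falls below \<open>e0\<close>.
\<close>

lemma tau_reparametrisation:
  assumes t1: "t1 \<in> lifespan T" and "0 < \<tau> t1" and g: "\<And>s. e0 \<le> s \<Longrightarrow> g s = 1 / sqrt s"
  shows "\<exists>w. continuous_on {0..\<tau> t1} w \<and>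
     (\<forall>n\<in>{0<..<\<tau> t1}. (w has_vector_derivative field g (\<lambda>_. 1) (w n)) (at n)) \<and>
     (\<forall>n\<in>{0..\<tau> t1}. \<exists>t\<in>{0..t1}. \<tau> t = n \<and> w n = pt (\<phi> t) (v t)) \<and> w 0 = pt (\<phi> 0) (v 0)"
proof -
  have "0 \<le> t1" using t1 by (simp add: lifespan_def)
  have sub: "{0..t1} \<subseteq> lifespan T" using lifespan_le[OF t1] by auto
  have inj: "inj_on \<tau> {0..t1}"
  proof (rule linorder_inj_onI')
    fix i j assume "i \<in> {0..t1}" "j \<in> {0..t1}" "i < j"
    moreover from this have "j \<in> lifespan T" using sub by blast
    ultimately show "\<tau> i \<noteq> \<tau> j" using tau_strict_mono[of i j] by auto
  qed
  have img: "\<tau> ` {0..t1} = {0..\<tau> t1}"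
  proof
    show "\<tau> ` {0..t1} \<subseteq> {0..\<tau> t1}"
    proof
      fix n assume "n \<in> \<tau> ` {0..t1}"
      then obtain t where "t \<in> {0..t1}" "n = \<tau> t" by blast
      then show "n \<in> {0..\<tau> t1}" using tau_mono[of 0 t] tau_mono[of t t1] sub t1 by auto
    qed
    show "{0..\<tau> t1} \<subseteq> \<tau> ` {0..t1}"
    proof
      fix n assume "n \<in> {0..\<tau> t1}"
      then obtain t where "0 \<le> t" "t \<le> t1" "\<tau> t = n"
        using IVT'[of \<tau> 0 n t1] \<open>0 \<le> t1\<close> tau_cont[OF sub] by auto
      then show "n \<in> \<tau> ` {0..t1}" by auto
    qed
  qed
  define \<sigma> where "\<sigma> = the_inv_into {0..t1} \<tau>"
  have \<sigma>: "\<sigma> n \<in> {0..t1}" "\<tau> (\<sigma> n) = n" if "n \<in> {0..\<tau> t1}" for n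
    using the_inv_into_into[OF inj, of n "{0..t1}"] f_the_inv_into_f[OF inj, of n] that img
    by (auto simp: \<sigma>_def)
  have \<sigma>\<tau>: "\<sigma> (\<tau> t) = t" if "t \<in> {0..t1}" for t
    using the_inv_into_f_f[OF inj that] by (simp add: \<sigma>_def)
  have c\<sigma>: "continuous_on {0..\<tau> t1} \<sigma>"
    using continuous_on_inv[OF tau_cont[OF sub] compact_Icc, of \<sigma>] \<sigma>\<tau> img by auto
  define w where "w n = pt (\<phi> (\<sigma> n)) (v (\<sigma> n))" for n
  have "continuous_on {0..\<tau> t1} (\<lambda>n. \<phi> (\<sigma> n))" "continuous_on {0..\<tau> t1} (\<lambda>n. v (\<sigma> n))"
    using DERIV_continuous_on[OF phi_deriv] DERIV_continuous_on[OF v_deriv] \<sigma>(1) sub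
    by (auto intro!: continuous_on_compose2[OF _ c\<sigma>])
  then have "continuous_on {0..\<tau> t1} w"
    unfolding w_def pt_def by (intro continuous_intros)
  moreover have "(w has_vector_derivative field g (\<lambda>_. 1) (w n)) (at n)" if n: "n \<in> {0<..<\<tau> t1}" for n
  proof -
    have n': "n \<in> {0..\<tau> t1}" using n by auto
    have "\<sigma> n \<noteq> 0" "\<sigma> n \<noteq> t1" using \<sigma>(2)[OF n'] n by force+
    with \<sigma>(1)[OF n'] have s: "0 < \<sigma> n" "\<sigma> n < t1" by auto
    then have s': "\<sigma> n \<in> lifespan T" and at: "at (\<sigma> n) within lifespan T = at (\<sigma> n)"
      using sub at_within_lifespan[OF t1] by auto
    have pos: "0 < \<epsilon> (\<sigma> n)" using energy_ge[OF s'] e0_pos by simp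
    have "isCont \<sigma> n"
      by (rule continuous_on_interior[OF c\<sigma>]) (use n in simp)
    then have d\<sigma>: "(\<sigma> has_real_derivative inverse (sqrt (\<epsilon> (\<sigma> n)))) (at n)"
      using tau_deriv[OF s'] pos n \<sigma> unfolding at
      by (intro DERIV_inverse_function[where f = \<tau> and a = 0 and b = "\<tau> t1"]) auto
    have "((\<lambda>n. \<phi> (\<sigma> n)) has_real_derivative v (\<sigma> n) * inverse (sqrt (\<epsilon> (\<sigma> n)))) (at n)"
      "((\<lambda>n. v (\<sigma> n)) has_real_derivative
         (- deriv V (\<phi> (\<sigma> n)) + sqrt 3 * sqrt (\<epsilon> (\<sigma> n)) * v (\<sigma> n)) * inverse (sqrt (\<epsilon> (\<sigma> n)))) (at n)"
      using DERIV_chain2[OF phi_deriv[OF s', unfolded at] d\<sigma>] DERIV_chain2[OF v_deriv[OF s', unfolded at] d\<sigma>] by auto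
    then have "(w has_vector_derivative
       pt (v (\<sigma> n) * inverse (sqrt (\<epsilon> (\<sigma> n))))
          ((- deriv V (\<phi> (\<sigma> n)) + sqrt 3 * sqrt (\<epsilon> (\<sigma> n)) * v (\<sigma> n)) * inverse (sqrt (\<epsilon> (\<sigma> n))))) (at n)"
      unfolding w_def pt_def
      by (auto intro!: derivative_eq_intros simp: has_real_derivative_iff_has_vector_derivative)
    moreover have "pt (v (\<sigma> n) * inverse (sqrt (\<epsilon> (\<sigma> n))))
          ((- deriv V (\<phi> (\<sigma> n)) + sqrt 3 * sqrt (\<epsilon> (\<sigma> n)) * v (\<sigma> n)) * inverse (sqrt (\<epsilon> (\<sigma> n))))
        = field g (\<lambda>_. 1) (w n)"
    proof -
      have "sqrt 3 * sqrt (\<epsilon> (\<sigma> n)) * v (\<sigma> n) * inverse (sqrt (\<epsilon> (\<sigma> n))) = sqrt 3 * v (\<sigma> n)"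
        using pos by simp
      then show ?thesis
        using g[OF energy_ge[OF s']] unfolding field_def w_def pt_nth distrib_right
        by (simp add: inverse_eq_divide)
    qed
    ultimately show ?thesis by simp
  qed
  moreover have "\<exists>t\<in>{0..t1}. \<tau> t = n \<and> w n = pt (\<phi> t) (v t)" if "n \<in> {0..\<tau> t1}" for n
    using \<sigma>[OF that] by (auto simp: w_def)
  moreover have "w 0 = pt (\<phi> 0) (v 0)"
    using \<sigma>\<tau>[of 0] \<open>0 \<le> t1\<close> by (simp add: w_def)
  ultimately show ?thesis by blast
qed

end

section \<open>Fast growth of the energy density for almost all data\<close>

lemma linear_times_geometric_summable:
  fixes x :: real
  assumes "0 \<le> x" "x < 1"
  shows "summable (\<lambda>n. c * real (Suc n) * x ^ n)"
proof -
  have "summable (\<lambda>n. of_nat (Suc n) * x ^ n)"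
    using geometric_deriv_sums[of x] assms by (auto simp: sums_iff)
  from summable_mult[OF this, of c] show ?thesis by (simp add: mult.assoc)
qed

lemma measure_pt_box:
  assumes "0 \<le> A" "0 \<le> B"
  shows "measure lebesgue (cbox (pt (- A) (- B)) (pt A B)) = (2 * A) * (2 * B)"
proof -
  have "cbox (pt (- A) (- B)) (pt A B) \<noteq> {}"
    using assms by (auto simp: interval_ne_empty_cart forall_2)
  then have "measure lborel (cbox (pt (- A) (- B)) (pt A B)) = (\<Prod>i\<in>UNIV. pt A B $ i - pt (- A) (- B) $ i)"
    by (rule content_cbox_cart)
  also have "\<dots> = (2 * A) * (2 * B)" by (simp add: UNIV_2)
  finally show ?thesis by simp
qed

context bounded_below_potential
begin

text \<open>
  Solutions that remain in a box of half-widths \<open>A\<close> and \<open>B\<close> up to the time \<open>n\<close> end in that box; its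
  enlargement by 1 in all directions has area \<open>4 (A + 1) (B + 1)\<close>, and the flow has expanded areas by
  \<open>exp (\<surd>3 n)\<close>.
\<close>

lemma slow_data_measure:
  assumes g: "\<And>s. (g has_real_derivative g' s) (at s)" "continuous_on UNIV g'"
    and "0 < n" "0 \<le> A" "0 \<le> B"
  shows "\<exists>S. compact S \<and> measure lebesgue S \<le> 8 * exp (- sqrt 3 * n) * (A + 1) * (B + 1) \<and>
     (\<forall>w. continuous_on {0..n} w \<longrightarrow>
       (\<forall>s\<in>{0<..<n}. (w has_vector_derivative field g (\<lambda>_. 1) (w s)) (at s)) \<longrightarrow>
       (\<forall>s\<in>{0..n}. \<bar>w s $ 1\<bar> \<le> A \<and> \<bar>w s $ 2\<bar> \<le> B) \<longrightarrow> w 0 \<in> S)"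
proof -
  define Q where "Q = cbox (pt (- (A + 1)) (- (B + 1))) (pt (A + 1) (B + 1))"
  define F' where "F' = field' g g' (\<lambda>_. 1) (\<lambda>_. 0)"
  have "(field g (\<lambda>_. 1) has_derivative F' z) (at z)" for z
    unfolding F'_def by (intro field_has_derivative g) auto
  moreover have "continuous_on UNIV (\<lambda>z. F' z k)" for k
    unfolding F'_def by (intro field'_continuous g) auto
  moreover have "F' z (axis 1 1) $ 1 + F' z (axis 2 1) $ 2 = sqrt 3" for z
    unfolding F'_def by (rule field_divergence)
  moreover have "0 < sqrt (3 :: real)" "compact Q" by (auto simp: Q_def)
  ultimately obtain S where S: "compact S" "measure lebesgue S \<le> 2 * exp (- sqrt 3 * n) * measure lebesgue Q"
    and "\<forall>w. continuous_on {0..n} w \<longrightarrow>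
       (\<forall>s\<in>{0<..<n}. (w has_vector_derivative field g (\<lambda>_. 1) (w s)) (at s)) \<longrightarrow>
       (\<forall>s\<in>{0..n}. norm (w s) \<le> A + B) \<longrightarrow> cball (w n) 1 \<subseteq> Q \<longrightarrow> w 0 \<in> S"
    using area_bound_of_expanding_flow[of "field g (\<lambda>_. 1)" F' "sqrt 3" n Q "A + B"] \<open>0 < n\<close> by blast
  then have S': "w 0 \<in> S" if "continuous_on {0..n} w"
      "\<forall>s\<in>{0<..<n}. (w has_vector_derivative field g (\<lambda>_. 1) (w s)) (at s)"
      "\<forall>s\<in>{0..n}. norm (w s) \<le> A + B" "cball (w n) 1 \<subseteq> Q" for w
    using that by blast
  have "w 0 \<in> S" if w: "continuous_on {0..n} w"
      "\<forall>s\<in>{0<..<n}. (w has_vector_derivative field g (\<lambda>_. 1) (w s)) (at s)"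
      "\<forall>s\<in>{0..n}. \<bar>w s $ 1\<bar> \<le> A \<and> \<bar>w s $ 2\<bar> \<le> B" for w
  proof (rule S'[OF w(1,2)])
    show "\<forall>s\<in>{0..n}. norm (w s) \<le> A + B"
      using w(3) norm_pt_le by (meson add_mono order_trans)
    show "cball (w n) 1 \<subseteq> Q"
    proof
      fix z assume "z \<in> cball (w n) 1"
      then have "\<bar>z $ i - w n $ i\<bar> \<le> 1" for i
        using component_le_norm_cart[of "z - w n" i] by (simp add: dist_norm norm_minus_commute)
      moreover have "\<bar>w n $ 1\<bar> \<le> A" "\<bar>w n $ 2\<bar> \<le> B" using w(3) \<open>0 < n\<close> by auto
      ultimately have "\<bar>z $ 1\<bar> \<le> A + 1" "\<bar>z $ 2\<bar> \<le> B + 1"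
        by (smt (verit))+
      then show "z \<in> Q" unfolding Q_def by (auto simp: mem_box_cart forall_2)
    qed
  qed
  moreover have "2 * exp (- sqrt 3 * n) * measure lebesgue Q = 8 * exp (- sqrt 3 * n) * (A + 1) * (B + 1)"
    using assms measure_pt_box[of "A + 1" "B + 1"] unfolding Q_def by (simp add: algebra_simps)
  ultimately show ?thesis using S by auto
qed

text \<open>
  The Borel-Cantelli argument. A solution whose energy density at \<open>\<tau> = n\<close> is at most
  \<open>exp (2 \<surd>3 \<theta> n)\<close> has \<open>\<bar>\<phi>\<bar> \<le> A n\<close> and \<open>\<bar>v\<bar> \<le> B n\<close> up to that time, so its initial data lie in \<open>S n\<close>,
  and the measures of the sets \<open>S n\<close> are summable because \<open>\<theta> < 1\<close>. The loss of one unit of \<open>\<tau>\<close> in the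
  conclusion comes from passing from integers to all values of \<open>\<tau>\<close>.
\<close>

lemma AE_fast_growth_bounded_data:
  assumes "0 < e0" "0 \<le> m" "0 \<le> \<theta>" "\<theta> < 1"
  shows "AE z in (lebesgue :: (real^2) measure). \<forall>T a \<phi> v. maximal_collapsing_solution V T a \<phi> v \<longrightarrow>
     \<phi> 0 = z $ 1 \<longrightarrow> v 0 = z $ 2 \<longrightarrow> e0 \<le> energy V (z $ 1) (z $ 2) \<longrightarrow> norm z \<le> m \<longrightarrow>
     (\<exists>N0::nat. \<forall>t\<in>lifespan T. real N0 \<le> log_contraction a t \<longrightarrow>
        exp (2 * sqrt 3 * \<theta> * (log_contraction a t - 1)) \<le> energy V (\<phi> t) (v t))"
proof -
  obtain g g' where g: "\<And>s. (g has_real_derivative g' s) (at s)" "continuous_on UNIV g'"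
    and ge0: "\<And>s. e0 \<le> s \<Longrightarrow> g s = 1 / sqrt s"
    using inverse_sqrt_C1_extension[OF \<open>0 < e0\<close>] by blast
  \<comment> \<open>\<open>K\<close> bounds the speed \<open>\<bar>d\<phi>/d\<tau>\<bar>\<close> of the field, and \<open>(q n)\<^sup>2\<close> is the threshold for slow growth at \<open>\<tau> = n\<close>.\<close>
  define K where "K = sqrt (1 + 2 * C / e0)"
  have K: "0 \<le> K" "K\<^sup>2 = 1 + 2 * C / e0" using C_nonneg \<open>0 < e0\<close> by (auto simp: K_def)
  define A where "A n = m + K * real n" for n :: nat
  define q where "q n = exp (sqrt 3 * \<theta> * real n)" for n :: nat
  define B where "B n = (1 + sqrt (2 * C)) * q n" for n :: nat
  have q1: "1 \<le> q n" for n using \<open>0 \<le> \<theta>\<close> by (simp add: q_def)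
  have A0: "0 \<le> A n" and B0: "0 \<le> B n" for n
    using \<open>0 \<le> m\<close> K(1) q1[of n] C_nonneg by (auto simp: A_def B_def)
  have B_sq: "(q n)\<^sup>2 + 2 * C \<le> (B n)\<^sup>2" for n
  proof -
    have "2 * C * 1 \<le> 2 * C * (q n)\<^sup>2"
      using q1[of n] C_nonneg by (intro mult_left_mono one_le_power) auto
    moreover have "(1 + 2 * C) * (q n)\<^sup>2 \<le> (1 + sqrt (2 * C))\<^sup>2 * (q n)\<^sup>2"
      using C_nonneg by (intro mult_right_mono) (auto simp: power2_sum)
    moreover have "(B n)\<^sup>2 = (1 + sqrt (2 * C))\<^sup>2 * (q n)\<^sup>2"
      unfolding B_def by (rule power_mult_distrib)
    ultimately show ?thesis by (simp add: distrib_right)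
  qed
  have "\<forall>n. \<exists>S. compact S \<and> (0 < n \<longrightarrow> measure lebesgue S \<le> 8 * exp (- sqrt 3 * real n) * (A n + 1) * (B n + 1) \<and>
     (\<forall>w. continuous_on {0..real n} w \<longrightarrow>
       (\<forall>s\<in>{0<..<real n}. (w has_vector_derivative field g (\<lambda>_. 1) (w s)) (at s)) \<longrightarrow>
       (\<forall>s\<in>{0..real n}. \<bar>w s $ 1\<bar> \<le> A n \<and> \<bar>w s $ 2\<bar> \<le> B n) \<longrightarrow> w 0 \<in> S))" (is "\<forall>n. \<exists>S. ?P n S")
  proof
    fix n
    show "\<exists>S. ?P n S"
    proof (cases "0 < n")
      case True
      then have "0 < real n" by simp
      from slow_data_measure[OF g this A0 B0] show ?thesis by blast
    qed (use compact_empty in blast)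
  qed
  then obtain S where S: "\<And>n. ?P n (S n)" by metis
  define x where "x = exp (- sqrt 3 * (1 - \<theta>))"
  have x: "0 \<le> x" "x < 1" using \<open>\<theta> < 1\<close> by (auto simp: x_def)
  define c where "c = 8 * (m + 1 + K) * (2 + sqrt (2 * C))"
  have bound: "measure lebesgue (S n) \<le> c * real (Suc n) * x ^ n" if "1 \<le> n" for n
  proof -
    have "A n + 1 \<le> (m + 1 + K) * real (Suc n)"
      using \<open>0 \<le> m\<close> K(1) by (simp add: A_def algebra_simps)
    moreover have "B n + 1 \<le> (2 + sqrt (2 * C)) * q n"
      using q1[of n] by (simp add: B_def algebra_simps)
    ultimately have "(A n + 1) * (B n + 1) \<le> ((m + 1 + K) * real (Suc n)) * ((2 + sqrt (2 * C)) * q n)"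
      using A0[of n] B0[of n] \<open>0 \<le> m\<close> K(1) by (intro mult_mono) auto
    then have "8 * exp (- sqrt 3 * real n) * ((A n + 1) * (B n + 1))
       \<le> 8 * exp (- sqrt 3 * real n) * (((m + 1 + K) * real (Suc n)) * ((2 + sqrt (2 * C)) * q n))"
      by (intro mult_left_mono) auto
    also have "\<dots> = c * real (Suc n) * (exp (- sqrt 3 * real n) * q n)"
      unfolding c_def by (simp only: mult_ac)
    also have "exp (- sqrt 3 * real n) * q n = x ^ n"
      unfolding q_def x_def by (simp add: exp_of_nat_mult[symmetric] exp_add[symmetric] algebra_simps)
    finally show ?thesis using S[of n] that by (simp add: mult.assoc)
  qed
  have "AE z in lebesgue. \<forall>\<^sub>F n in sequentially. z \<in> space lebesgue - S n"
  proof (rule borel_cantelli_AE1)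
    fix n
    have "S n \<in> lmeasurable" using S[of n] lmeasurable_compact by blast
    then show "S n \<in> sets lebesgue" "emeasure lebesgue (S n) < \<infinity>"
      by (auto simp: fmeasurable_def)
  next
    show "summable (\<lambda>n. measure lebesgue (S n))"
      by (rule summable_comparison_test'[OF linear_times_geometric_summable[OF x, of c], of 1])
         (use bound in auto)
  qed
  then show ?thesis
  proof (rule AE_mp, intro AE_I2 impI allI)
    fix z :: "real^2" and T a \<phi> v
    assume "\<forall>\<^sub>F n in sequentially. z \<in> space lebesgue - S n"
      and max: "maximal_collapsing_solution V T a \<phi> v" and init: "\<phi> 0 = z $ 1" "v 0 = z $ 2"
      and e: "e0 \<le> energy V (z $ 1) (z $ 2)" and z: "norm z \<le> m"
    then obtain N1 where N1: "\<And>n. N1 \<le> n \<Longrightarrow> z \<notin> S n"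
      unfolding eventually_sequentially by auto
    interpret collapse V C T a \<phi> v e0
      using max e init \<open>0 < e0\<close> by unfold_locales (auto simp: maximal_collapsing_solution_def)
    have fast: "(q n)\<^sup>2 < \<epsilon> t" if n: "Suc N1 \<le> n" and t: "t \<in> lifespan T" and nt: "real n \<le> \<tau> t" for n t
    proof (rule ccontr)
      assume slow: "\<not> (q n)\<^sup>2 < \<epsilon> t"
      have "0 < \<tau> t" using n nt by linarith
      then obtain w where w: "continuous_on {0..\<tau> t} w"
         "\<forall>s\<in>{0<..<\<tau> t}. (w has_vector_derivative field g (\<lambda>_. 1) (w s)) (at s)"
         "\<forall>s\<in>{0..\<tau> t}. \<exists>r\<in>{0..t}. \<tau> r = s \<and> w s = pt (\<phi> r) (v r)" "w 0 = pt (\<phi> 0) (v 0)"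
        using tau_reparametrisation[OF t _ ge0] by blast
      have "\<bar>w s $ 1\<bar> \<le> A n \<and> \<bar>w s $ 2\<bar> \<le> B n" if "s \<in> {0..real n}" for s
      proof -
        have "s \<in> {0..\<tau> t}" using that nt by auto
        from bspec[OF w(3) this] obtain r where r: "0 \<le> r" "r \<le> t" "\<tau> r = s"
          and ws: "w s = pt (\<phi> r) (v r)" by auto
        have r': "r \<in> lifespan T" using lifespan_le[OF t] r by blast
        have "\<bar>\<phi> r - \<phi> 0\<bar> \<le> K * (\<tau> r - \<tau> 0)"
          using r(1) r' K v_sq_le lifespan_le[OF r'] by (intro phi_diff_le) auto
        also have "\<dots> \<le> K * real n" using r(3) that K(1) by (intro mult_left_mono) auto
        finally have "\<bar>\<phi> r\<bar> \<le> A n"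
          using z component_le_norm_cart[of z 1] init by (simp add: A_def)
        moreover have "(v r)\<^sup>2 \<le> (B n)\<^sup>2"
        proof -
          have "\<epsilon> r \<le> (q n)\<^sup>2" using energy_mono[OF r(1,2) t] slow by linarith
          then have "(v r)\<^sup>2 \<le> (q n)\<^sup>2 + 2 * C" using V_ge[of "\<phi> r"] by (simp add: energy_def)
          then show ?thesis using B_sq[of n] by linarith
        qed
        then have "\<bar>v r\<bar> \<le> B n" using B0[of n] abs_le_square_iff[of "v r" "B n"] by simp
        ultimately show ?thesis by (simp add: ws)
      qed
      moreover have "continuous_on {0..real n} w"
        by (rule continuous_on_subset[OF w(1)]) (use nt in auto)
      moreover have "\<forall>s\<in>{0<..<real n}. (w has_vector_derivative field g (\<lambda>_. 1) (w s)) (at s)"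
        using w(2) nt by auto
      ultimately have "w 0 \<in> S n" using S[of n] n by auto
      then show False using N1[of n] n w(4) init by simp
    qed
    show "\<exists>N0::nat. \<forall>t\<in>lifespan T. real N0 \<le> \<tau> t \<longrightarrow> exp (2 * sqrt 3 * \<theta> * (\<tau> t - 1)) \<le> \<epsilon> t"
    proof (intro exI ballI impI)
      fix t assume t: "t \<in> lifespan T" and *: "real (Suc N1) \<le> \<tau> t"
      define n where "n = nat \<lfloor>\<tau> t\<rfloor>"
      have n: "real n \<le> \<tau> t" "\<tau> t - 1 \<le> real n" "Suc N1 \<le> n"
        using * by (auto simp: n_def le_nat_floor)
      have "exp (2 * sqrt 3 * \<theta> * (\<tau> t - 1)) \<le> exp (2 * sqrt 3 * \<theta> * real n)"
        using n(2) \<open>0 \<le> \<theta>\<close> by (simp add: mult_left_mono)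
      also have "\<dots> = (q n)\<^sup>2" by (simp add: q_def power2_eq_square flip: exp_add)
      also have "\<dots> < \<epsilon> t" using fast[OF n(3) t n(1)] .
      finally show "exp (2 * sqrt 3 * \<theta> * (\<tau> t - 1)) \<le> \<epsilon> t" by simp
    qed
  qed
qed

lemma AE_fast_growth:
  assumes "0 \<le> \<theta>" "\<theta> < 1"
  shows "AE z in (lebesgue :: (real^2) measure). \<forall>T a \<phi> v. maximal_collapsing_solution V T a \<phi> v \<longrightarrow>
     \<phi> 0 = z $ 1 \<longrightarrow> v 0 = z $ 2 \<longrightarrow> 0 < energy V (z $ 1) (z $ 2) \<longrightarrow>
     (\<exists>N0::nat. \<forall>t\<in>lifespan T. real N0 \<le> log_contraction a t \<longrightarrow>
        exp (2 * sqrt 3 * \<theta> * (log_contraction a t - 1)) \<le> energy V (\<phi> t) (v t))"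
    (is "AE z in _. ?fast z")
proof -
  have "AE z in (lebesgue :: (real^2) measure). \<forall>k::nat. \<forall>T a \<phi> v. maximal_collapsing_solution V T a \<phi> v \<longrightarrow>
     \<phi> 0 = z $ 1 \<longrightarrow> v 0 = z $ 2 \<longrightarrow> 1 / real (Suc k) \<le> energy V (z $ 1) (z $ 2) \<longrightarrow> norm z \<le> real k \<longrightarrow>
     (\<exists>N0::nat. \<forall>t\<in>lifespan T. real N0 \<le> log_contraction a t \<longrightarrow>
        exp (2 * sqrt 3 * \<theta> * (log_contraction a t - 1)) \<le> energy V (\<phi> t) (v t))"
    (is "AE z in _. \<forall>k. ?bounded z k")
    unfolding AE_all_countable using assms by (intro allI AE_fast_growth_bounded_data) auto
  then show ?thesis
  proof (rule AE_mp, intro AE_I2 impI)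
    fix z :: "real^2" assume all: "\<forall>k. ?bounded z k"
    show "?fast z"
    proof (intro allI impI)
      fix T a \<phi> v assume sol: "maximal_collapsing_solution V T a \<phi> v" "\<phi> 0 = z $ 1" "v 0 = z $ 2"
        and e: "0 < energy V (z $ 1) (z $ 2)"
      obtain k :: nat where k: "max (1 / energy V (z $ 1) (z $ 2)) (norm z) \<le> real k"
        using real_arch_simple by blast
      then have "1 / energy V (z $ 1) (z $ 2) \<le> real (Suc k)" by simp
      then have "1 / real (Suc k) \<le> energy V (z $ 1) (z $ 2)"
        using e by (simp add: field_simps)
      with k all sol show "\<exists>N0::nat. \<forall>t\<in>lifespan T. real N0 \<le> log_contraction a t \<longrightarrow>
        exp (2 * sqrt 3 * \<theta> * (log_contraction a t - 1)) \<le> energy V (\<phi> t) (v t)"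
        by auto
    qed
  qed
qed

end

section \<open>From fast growth to the singularity\<close>

context bounded_below_potential
begin

lemma fast_growth_imp_singular:
  assumes max: "maximal_collapsing_solution V T a \<phi> v" and e: "0 < energy V (\<phi> 0) (v 0)"
    and \<eta>: "0 < \<eta>" "\<eta> < 1" and "0 \<le> K"
    and growth: "\<And>x. V x \<le> K * exp (2 * sqrt 3 * (1 - \<eta>) * \<bar>x\<bar>)"
    and fast: "\<And>t. t \<in> lifespan T \<Longrightarrow> real N0 \<le> log_contraction a t \<Longrightarrow>
      exp (2 * sqrt 3 * (1 - \<eta>\<^sup>2 / 2) * (log_contraction a t - 1)) \<le> energy V (\<phi> t) (v t)"
  shows "\<exists>t\<^sub>s. singular_at V T a \<phi> v t\<^sub>s \<and> filterlim (\<lambda>t. \<bar>v t\<bar>) at_top (at_left t\<^sub>s)"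
proof -
  interpret collapse V C T a \<phi> v "energy V (\<phi> 0) (v 0)"
    using max e by unfold_locales (auto simp: maximal_collapsing_solution_def)
  define c where "c = sqrt 3 * (1 - \<eta>\<^sup>2 / 2)"
  have "\<eta>\<^sup>2 < 1" using \<eta> by (simp add: power_less_one_iff abs_less_iff)
  then have "0 < c" by (simp add: c_def)
  have fast': "exp (2 * c * (\<tau> t - 1)) \<le> \<epsilon> t" if "t \<in> lifespan T" "real N0 \<le> \<tau> t" for t
    using fast[OF that] by (simp add: c_def mult.assoc)
  obtain t1 where t1: "t1 \<in> lifespan T" "real N0 \<le> \<tau> t1"
    using maximal_imp_tau_unbounded[OF max] by blast
  have "0 \<le> t1" using t1(1) by (simp add: lifespan_def)
  have late: "real N0 \<le> \<tau> t" if "t1 \<le> t" "t \<in> lifespan T" for t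
    using tau_mono[OF \<open>0 \<le> t1\<close> that] t1(2) by linarith
  \<comment> \<open>Fast growth gives \<open>(exp (- c \<tau>))' \<le> - c exp (- c)\<close>, and a positive quantity cannot decrease at this rate beyond \<open>R\<close>.\<close>
  define R where "R = t1 + exp (- c * \<tau> t1) / (c * exp (- c))"
  have bounded: "t \<le> R" if t: "t1 \<le> t" "t \<in> lifespan T" for t
  proof -
    have "- exp (- c * \<tau> t1) - c * exp (- c) * t1 \<le> - exp (- c * \<tau> t) - c * exp (- c) * t"
    proof (rule lifespan_nonneg_deriv_mono[OF _ _ \<open>0 \<le> t1\<close> t])
      show "((\<lambda>t. - exp (- c * \<tau> t) - c * exp (- c) * t) has_real_derivative
          c * sqrt (\<epsilon> r) * exp (- c * \<tau> r) - c * exp (- c)) (at r within lifespan T)"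
        if "r \<in> lifespan T" for r
        by (auto intro!: derivative_eq_intros tau_deriv[OF that])
      fix r assume r: "t1 < r" "r < t"
      then have r': "r \<in> lifespan T" using lifespan_le[OF t(2)] \<open>0 \<le> t1\<close> by auto
      have "exp (c * (\<tau> r - 1)) = sqrt (exp (2 * c * (\<tau> r - 1)))"
        by (rule real_sqrt_unique[symmetric]) (auto simp: power2_eq_square simp flip: exp_add)
      also have "\<dots> \<le> sqrt (\<epsilon> r)" using fast'[OF r' late[OF _ r']] r by simp
      finally have "exp (c * (\<tau> r - 1)) * exp (- c * \<tau> r) \<le> sqrt (\<epsilon> r) * exp (- c * \<tau> r)"
        by (rule mult_right_mono) auto
      moreover have "exp (c * (\<tau> r - 1)) * exp (- c * \<tau> r) = exp (- c)"
        by (simp add: algebra_simps flip: exp_add)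
      ultimately have "c * exp (- c) \<le> c * (sqrt (\<epsilon> r) * exp (- c * \<tau> r))"
        using \<open>0 < c\<close> by (intro mult_left_mono) (simp_all only: less_imp_le)
      then show "0 \<le> c * sqrt (\<epsilon> r) * exp (- c * \<tau> r) - c * exp (- c)"
        by (simp only: mult.assoc diff_ge_0_iff_ge)
    qed
    moreover have "0 < exp (- c * \<tau> t)" by simp
    ultimately have "c * exp (- c) * t \<le> c * exp (- c) * t1 + exp (- c * \<tau> t1)" by linarith
    then show ?thesis using \<open>0 < c\<close> unfolding R_def by (simp add: field_simps)
  qed
  have "T \<noteq> \<infinity>"
  proof
    assume "T = \<infinity>"
    then have "max t1 R + 1 \<in> lifespan T" using \<open>0 \<le> t1\<close> by (simp add: lifespan_def)
    from bounded[OF _ this] have "max t1 R + 1 \<le> R" by (simp add: max.coboundedI1)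
    then show False using max.cobounded2[of R t1] by linarith
  qed
  moreover have "0 < T" using sol unfolding collapsing_solution_def by blast
  ultimately obtain ts where T: "T = ereal ts" and "0 < ts" by (cases T) auto
  have life: "lifespan T = {0..<ts}" unfolding T by (rule lifespan_interval)
  have ev_late: "\<forall>\<^sub>F t in at_left ts. s < t \<and> t \<in> lifespan T" if "s \<in> lifespan T" for s
    using that unfolding life by (intro eventually_at_leftI[of s ts]) auto
  have tau_top: "filterlim \<tau> at_top (at_left ts)"
    unfolding filterlim_at_top
  proof
    fix Z
    obtain s where s: "s \<in> lifespan T" "Z \<le> \<tau> s" using maximal_imp_tau_unbounded[OF max] by blast
    show "\<forall>\<^sub>F t in at_left ts. Z \<le> \<tau> t"
      using ev_late[OF s(1)]
    proof eventually_elim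
      case (elim t)
      then show ?case using tau_mono[of s t] s unfolding life by auto
    qed
  qed
  have energy_top: "filterlim \<epsilon> at_top (at_left ts)"
  proof (rule filterlim_at_top_mono)
    have "filterlim (\<lambda>x. exp (2 * c * (x - 1))) at_top at_top"
      using \<open>0 < c\<close> by real_asymp
    then show "filterlim (\<lambda>t. exp (2 * c * (\<tau> t - 1))) at_top (at_left ts)"
      by (rule filterlim_compose[OF _ tau_top])
    show "\<forall>\<^sub>F t in at_left ts. exp (2 * c * (\<tau> t - 1)) \<le> \<epsilon> t"
      using ev_late[OF t1(1)] by eventually_elim (use fast' late in auto)
  qed
  have a_zero: "(a \<longlongrightarrow> 0) (at_left ts)"
  proof (rule Lim_transform_eventually)
    have "((\<lambda>x. a 0 * exp (- x / sqrt 3)) \<longlongrightarrow> 0) at_top" by real_asymp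
    then show "((\<lambda>t. a 0 * exp (- \<tau> t / sqrt 3)) \<longlongrightarrow> 0) (at_left ts)"
      by (rule filterlim_compose[OF _ tau_top])
    show "\<forall>\<^sub>F t in at_left ts. a 0 * exp (- \<tau> t / sqrt 3) = a t"
      using ev_late[OF t1(1)] by eventually_elim (use a_eq in auto)
  qed
  have "\<forall>\<^sub>F t in at_left ts. C / \<eta> \<le> \<epsilon> t \<and> t1 < t \<and> t \<in> lifespan T"
    using energy_top ev_late[OF t1(1)] unfolding filterlim_at_top by (auto intro: eventually_conj)
  then obtain t2 where t2: "C / \<eta> \<le> \<epsilon> t2" "t1 < t2" "t2 \<in> lifespan T"
    using eventually_happens'[of "at_left ts"] by (auto simp: trivial_limit_at_left_real)
  have "0 \<le> t2" "0 \<le> \<tau> t2" using t2 \<open>0 \<le> t1\<close> late[of t2] by (auto intro: order_trans[of _ "real N0"])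
  \<comment> \<open>From \<open>t2\<close> on, \<open>2 C \<le> 2 \<eta> \<epsilon>\<close>, so \<open>v\<^sup>2 \<le> \<epsilon> + 2 C\<close> is at most \<open>(1 + \<eta>)\<^sup>2 \<epsilon>\<close>.\<close>
  define D where "D = \<bar>\<phi> t2\<bar>"
  have \<phi>_le: "\<bar>\<phi> t\<bar> \<le> D + (1 + \<eta>) * \<tau> t" if t: "t2 \<le> t" "t \<in> lifespan T" for t
  proof -
    have "\<bar>\<phi> t - \<phi> t2\<bar> \<le> (1 + \<eta>) * (\<tau> t - \<tau> t2)"
    proof (rule phi_diff_le[OF \<open>0 \<le> t2\<close> t])
      fix r assume r: "t2 < r" "r < t"
      then have r': "r \<in> lifespan T" using lifespan_le[OF t(2)] \<open>0 \<le> t2\<close> by auto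
      have "C / \<eta> \<le> \<epsilon> r" using energy_mono[OF \<open>0 \<le> t2\<close> _ r'] t2(1) r by force
      then have "C \<le> \<eta> * \<epsilon> r" using \<eta> by (simp add: field_simps)
      moreover have "0 \<le> \<eta>\<^sup>2 * \<epsilon> r" using energy_nonneg[OF r'] by simp
      moreover have "(v r)\<^sup>2 \<le> \<epsilon> r + 2 * C" using V_ge[of "\<phi> r"] by (simp add: energy_def)
      moreover have "(1 + \<eta>)\<^sup>2 * \<epsilon> r = \<epsilon> r + 2 * (\<eta> * \<epsilon> r) + \<eta>\<^sup>2 * \<epsilon> r"
        by (simp add: power2_sum distrib_right)
      ultimately show "(v r)\<^sup>2 \<le> (1 + \<eta>)\<^sup>2 * \<epsilon> r" by linarith
    qed (use \<eta> in auto)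
    also have "\<dots> \<le> (1 + \<eta>) * \<tau> t" using \<open>0 \<le> \<tau> t2\<close> \<eta> by (intro mult_left_mono) auto
    finally show ?thesis unfolding D_def by linarith
  qed
  \<comment> \<open>The exponent \<open>b\<close> combines the rate \<open>1 - \<eta>\<close> of \<open>V\<close> with the speed \<open>1 + \<eta>\<close> of \<open>\<phi>\<close>; it stays below \<open>2 * c\<close>.\<close>
  define b where "b = 2 * sqrt 3 * (1 - \<eta>\<^sup>2)"
  define K1 where "K1 = K * exp (2 * sqrt 3 * (1 - \<eta>) * D)"
  have V_le: "V (\<phi> t) \<le> K1 * exp (b * \<tau> t)" if t: "t2 \<le> t" "t \<in> lifespan T" for t
  proof -
    have "2 * sqrt 3 * (1 - \<eta>) * \<bar>\<phi> t\<bar> \<le> 2 * sqrt 3 * (1 - \<eta>) * (D + (1 + \<eta>) * \<tau> t)"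
      using \<phi>_le[OF t] \<eta> by (intro mult_left_mono) auto
    also have "\<dots> = 2 * sqrt 3 * (1 - \<eta>) * D + b * \<tau> t"
      by (simp add: b_def algebra_simps power2_eq_square)
    finally have "K * exp (2 * sqrt 3 * (1 - \<eta>) * \<bar>\<phi> t\<bar>) \<le> K * exp (2 * sqrt 3 * (1 - \<eta>) * D + b * \<tau> t)"
      using \<open>0 \<le> K\<close> by (intro mult_left_mono) auto
    also have "\<dots> = K1 * exp (b * \<tau> t)" by (simp add: K1_def exp_add)
    finally show ?thesis using growth[of "\<phi> t"] by linarith
  qed
  have bc: "0 < b" "b < 2 * c" using \<eta> \<open>\<eta>\<^sup>2 < 1\<close> by (auto simp: b_def c_def)
  have v_sq_top: "filterlim (\<lambda>t. (v t)\<^sup>2) at_top (at_left ts)"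
  proof (rule filterlim_at_top_mono)
    have "filterlim (\<lambda>x. exp (2 * c * (x - 1)) - 2 * (K1 * exp (b * x))) at_top at_top"
      using bc \<open>0 < c\<close> by real_asymp
    then show "filterlim (\<lambda>t. exp (2 * c * (\<tau> t - 1)) - 2 * (K1 * exp (b * \<tau> t))) at_top (at_left ts)"
      by (rule filterlim_compose[OF _ tau_top])
    show "\<forall>\<^sub>F t in at_left ts. exp (2 * c * (\<tau> t - 1)) - 2 * (K1 * exp (b * \<tau> t)) \<le> (v t)\<^sup>2"
      using ev_late[OF t2(3)]
    proof eventually_elim
      case (elim t)
      then show ?case
        using V_le[of t] fast'[of t] late[of t] t2(2) by (auto simp: energy_def)
    qed
  qed
  have "filterlim (\<lambda>t. \<bar>v t\<bar>) at_top (at_left ts)"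
    using filterlim_compose[OF sqrt_at_top v_sq_top] by simp
  then show ?thesis
    using T energy_top a_zero unfolding singular_at_def by blast
qed

end

text \<open>
  Where \<open>V\<close> is positive, the bound on the logarithmic slope is the differential inequality
  \<open>\<bar>V'\<bar> \<le> 2 \<surd>3 (1 - \<eta>) V\<close>, so \<open>V\<close> grows at most exponentially with this rate. The constant 1 in the
  definition of the class thus corresponds to the rate \<open>2 \<surd>3\<close>, at which the energy density of a field
  with negligible potential grows in the time \<open>\<tau>\<close>.
\<close>

lemma class_C_growth:
  assumes "class_C V"
  shows "\<exists>\<eta> K. 0 < \<eta> \<and> \<eta> < 1 \<and> 0 \<le> K \<and> (\<forall>x. V x \<le> K * exp (2 * sqrt 3 * (1 - \<eta>) * \<bar>x\<bar>))"
proof -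
  obtain C where "bounded_below_potential V C"
    using class_V_imp_bounded_below_potential assms unfolding class_C_def by blast
  then interpret bounded_below_potential V C .
  have slope: "\<exists>y<1. \<forall>\<^sub>F x in F. \<bar>log_slope V x\<bar> < y" if L: "Limsup F (\<lambda>x. ereal \<bar>log_slope V x\<bar>) < 1" for F
  proof -
    obtain y where y: "Limsup F (\<lambda>x. ereal \<bar>log_slope V x\<bar>) < ereal y" "ereal y < 1"
      using ereal_dense2[OF L] by blast
    have "\<forall>\<^sub>F x in F. \<bar>log_slope V x\<bar> < y"
      using Limsup_lessD[OF y(1)] by simp
    then show ?thesis using y(2) by (intro exI[of _ y]) (auto simp: one_ereal_def)
  qed
  obtain y1 where y1: "y1 < 1" "\<forall>\<^sub>F x in at_top. \<bar>log_slope V x\<bar> < y1"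
    using slope[of at_top] assms unfolding class_C_def by blast
  obtain y2 where y2: "y2 < 1" "\<forall>\<^sub>F x in at_bot. \<bar>log_slope V x\<bar> < y2"
    using slope[of at_bot] assms unfolding class_C_def by blast
  obtain M1 where M1: "\<And>x. M1 \<le> x \<Longrightarrow> \<bar>log_slope V x\<bar> < y1"
    using y1(2) unfolding eventually_at_top_linorder by blast
  obtain M2 where M2: "\<And>x. x \<le> M2 \<Longrightarrow> \<bar>log_slope V x\<bar> < y2"
    using y2(2) unfolding eventually_at_bot_linorder by blast
  obtain c where c: "confining_level V c" using assms unfolding class_C_def by blast
  then obtain R where R: "\<And>x. V x \<le> c \<Longrightarrow> \<bar>x\<bar> \<le> R" and "0 < c"
    unfolding confining_level_def bounded_iff sublevel_def by auto
  define \<eta> where "\<eta> = Min {1 - y1, 1 - y2, 1 / 2}"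
  have \<eta>: "0 < \<eta>" "\<eta> < 1" "y1 \<le> 1 - \<eta>" "y2 \<le> 1 - \<eta>"
    using y1(1) y2(1) by (auto simp: \<eta>_def)
  define M where "M = \<bar>M1\<bar> + \<bar>M2\<bar> + \<bar>R\<bar> + 1"
  define l where "l = 2 * sqrt 3 * (1 - \<eta>)"
  have "0 < l" using \<eta> by (simp add: l_def)
  have slope_le: "\<bar>deriv V x\<bar> \<le> l * V x" if x: "M \<le> \<bar>x\<bar>" for x
  proof -
    have "0 < V x" using R[of x] x \<open>0 < c\<close> unfolding M_def by linarith
    have "\<bar>log_slope V x\<bar> \<le> 1 - \<eta>"
    proof (cases "0 \<le> x")
      case True
      then show ?thesis using M1[of x] x \<eta>(3) unfolding M_def by linarith
    next
      case False
      then show ?thesis using M2[of x] x \<eta>(4) unfolding M_def by linarith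
    qed
    then show ?thesis
      using \<open>0 < V x\<close> unfolding log_slope_def l_def
      by (simp add: abs_divide abs_mult divide_le_eq mult_ac)
  qed
  have "bounded (V ` {-M..M})"
    by (intro compact_imp_bounded compact_continuous_image V_cont compact_Icc)
  then obtain K where "0 < K" and K: "\<And>x. \<bar>x\<bar> \<le> M \<Longrightarrow> \<bar>V x\<bar> \<le> K"
    unfolding bounded_pos by (auto simp: abs_le_iff)
  have "0 < M" by (simp add: M_def)
  have "V x \<le> K * exp (l * \<bar>x\<bar>)" for x
  proof -
    have grow: "K * 1 \<le> K * exp (l * y)" if "0 \<le> y" for y
      using \<open>0 < K\<close> \<open>0 < l\<close> that by (intro mult_left_mono) auto
    consider "\<bar>x\<bar> \<le> M" | "M < x" | "x < - M" by linarith
    then show ?thesis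
    proof cases
      case 1
      then show ?thesis using K[of x] grow[of "\<bar>x\<bar>"] by simp
    next
      case 2
      have "V x * exp (- l * x) \<le> V M * exp (- l * M)"
      proof (rule DERIV_nonpos_imp_nonincreasing[of M x "\<lambda>x. V x * exp (- l * x)"])
        fix y assume "M \<le> y" "y \<le> x"
        then have "deriv V y - l * V y \<le> 0" using slope_le[of y] \<open>0 < M\<close> by auto
        then have "(deriv V y - l * V y) * exp (- l * y) \<le> 0" by (simp add: mult_le_0_iff)
        moreover have "((\<lambda>x. V x * exp (- l * x)) has_real_derivative (deriv V y - l * V y) * exp (- l * y)) (at y)"
          by (auto intro!: derivative_eq_intros V_deriv simp: algebra_simps)
        ultimately show "\<exists>d. ((\<lambda>x. V x * exp (- l * x)) has_real_derivative d) (at y) \<and> d \<le> 0" by blast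
      qed (use 2 in simp)
      also have "\<dots> \<le> K * 1"
        using K[of M] \<open>0 < M\<close> \<open>0 < l\<close> \<open>0 < K\<close> by (intro mult_mono) auto
      finally have "V x * exp (- l * x) * exp (l * x) \<le> K * 1 * exp (l * x)"
        by (rule mult_right_mono) simp
      then show ?thesis using 2 \<open>0 < M\<close> by (simp add: mult.assoc flip: exp_add)
    next
      case 3
      have "V x * exp (l * x) \<le> V (- M) * exp (l * - M)"
      proof (rule DERIV_nonneg_imp_nondecreasing[of x "- M" "\<lambda>x. V x * exp (l * x)"])
        fix y assume "x \<le> y" "y \<le> - M"
        then have "0 \<le> deriv V y + l * V y" using slope_le[of y] \<open>0 < M\<close> by auto
        then have "0 \<le> (deriv V y + l * V y) * exp (l * y)" by simp
        moreover have "((\<lambda>x. V x * exp (l * x)) has_real_derivative (deriv V y + l * V y) * exp (l * y)) (at y)"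
          by (auto intro!: derivative_eq_intros V_deriv simp: algebra_simps)
        ultimately show "\<exists>d. ((\<lambda>x. V x * exp (l * x)) has_real_derivative d) (at y) \<and> 0 \<le> d" by blast
      qed (use 3 in simp)
      also have "\<dots> \<le> K * 1"
        using K[of "- M"] \<open>0 < M\<close> \<open>0 < l\<close> \<open>0 < K\<close> by (intro mult_mono) auto
      finally have "V x * exp (l * x) * exp (- l * x) \<le> K * 1 * exp (- l * x)"
        by (rule mult_right_mono) simp
      then show ?thesis using 3 \<open>0 < M\<close> by (simp add: mult.assoc flip: exp_add)
    qed
  qed
  then show ?thesis using \<eta>(1,2) \<open>0 < K\<close> unfolding l_def by (intro exI[of _ \<eta>] exI[of _ K]) auto
qed

lemma AE_pair_of_AE_vec2:
  assumes "AE z in (lebesgue :: (real^2) measure). P (z $ 1) (z $ 2)"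
  shows "AE (x, y) in (lebesgue :: (real \<times> real) measure). P x y"
proof -
  obtain N :: "(real^2) set" where N: "{z. \<not> P (z $ 1) (z $ 2)} \<subseteq> N" "negligible N"
    using assms unfolding eventually_ae_filter negligible_iff_null_sets by auto
  define f where "f z = (z $ 1, z $ 2)" for z :: "real^2"
  have "negligible (f ` N)"
  proof (rule negligible_locally_Lipschitz_image)
    fix x assume "x \<in> N"
    have "norm (f y - f x) \<le> 2 * norm (y - x)" for y
      using norm_Pair_le[of "y $ 1 - x $ 1" "y $ 2 - x $ 2"]
        component_le_norm_cart[of "y - x" 1] component_le_norm_cart[of "y - x" 2]
      by (simp add: f_def)
    then show "\<exists>T B. open T \<and> x \<in> T \<and> (\<forall>y\<in>N \<inter> T. norm (f y - f x) \<le> B * norm (y - x))"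
      by (intro exI[of _ UNIV] exI[of _ 2]) auto
  qed (use N in auto)
  moreover have "{p. \<not> (case p of (x, y) \<Rightarrow> P x y)} \<subseteq> f ` N"
  proof
    fix p assume "p \<in> {p. \<not> (case p of (x, y) \<Rightarrow> P x y)}"
    then have "\<not> P (pt (fst p) (snd p) $ 1) (pt (fst p) (snd p) $ 2)"
      by (simp add: case_prod_beta)
    then have "pt (fst p) (snd p) \<in> N" using N(1) by blast
    moreover have "f (pt (fst p) (snd p)) = p" by (simp add: f_def)
    ultimately show "p \<in> f ` N" by (metis image_eqI)
  qed
  ultimately show ?thesis
    unfolding eventually_ae_filter negligible_iff_null_sets by auto
qed

text \<open>
  For each field value only the two velocities \<open>\<plusminus> \<surd>(-2 V)\<close> have vanishing energy density.
\<close>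

lemma (in bounded_below_potential) AE_energy_nonzero:
  "AE (x, y) in (lebesgue :: (real \<times> real) measure). energy V x y \<noteq> 0"
proof -
  have "continuous_on UNIV (\<lambda>p. energy V (fst p) (snd p))"
    by (intro energy_cont continuous_intros)
  then have "open {p. energy V (fst p) (snd p) \<noteq> 0}"
    by (intro open_Collect_neq continuous_on_const)
  then have meas: "{p. energy V (fst p) (snd p) \<noteq> 0} \<in> sets (borel \<Otimes>\<^sub>M borel)"
    unfolding borel_prod by (rule borel_open)
  have "AE y in lborel. energy V x y \<noteq> 0" for x
  proof -
    have "{y. energy V x y = 0} \<subseteq> {sqrt (- 2 * V x), - sqrt (- 2 * V x)}"
    proof
      fix y assume "y \<in> {y. energy V x y = 0}"
      then have "- 2 * V x = y\<^sup>2" by (simp add: energy_def)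
      then show "y \<in> {sqrt (- 2 * V x), - sqrt (- 2 * V x)}" by auto
    qed
    then have "finite {y. energy V x y = 0}" by (rule finite_subset) simp
    then show ?thesis
      by (intro AE_I'[OF finite_imp_null_set_lborel]) auto
  qed
  then have "AE p in lborel \<Otimes>\<^sub>M lborel. energy V (fst p) (snd p) \<noteq> 0"
    by (intro lborel_pair.AE_pair_measure) (use meas in \<open>auto simp: space_pair_measure\<close>)
  then show ?thesis
    unfolding lborel_prod case_prod_beta by (rule AE_completion)
qed

theorem theorem4p12:
  fixes V :: "real \<Rightarrow> real" and Vstar :: real
  assumes "class_C V"
    and "confining_level V Vstar"
  shows "AE (\<phi>\<^sub>0, v\<^sub>0) in (lebesgue :: (real \<times> real) measure).
           \<phi>\<^sub>0 \<in> sublevel V Vstar \<longrightarrow> 0 \<le> energy V \<phi>\<^sub>0 v\<^sub>0 \<longrightarrow>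
           (\<forall>T a \<phi> v. maximal_collapsing_solution V T a \<phi> v \<longrightarrow> \<phi> 0 = \<phi>\<^sub>0 \<longrightarrow> v 0 = v\<^sub>0 \<longrightarrow>
              (\<exists>t\<^sub>s. singular_at V T a \<phi> v t\<^sub>s \<and>
                    filterlim (\<lambda>t. \<bar>v t\<bar>) at_top (at_left t\<^sub>s)))"
proof -
  obtain C where "bounded_below_potential V C"
    using class_V_imp_bounded_below_potential assms unfolding class_C_def by blast
  then interpret bounded_below_potential V C .
  obtain \<eta> K where \<eta>: "0 < \<eta>" "\<eta> < 1" "0 \<le> K"
    and growth: "\<And>x. V x \<le> K * exp (2 * sqrt 3 * (1 - \<eta>) * \<bar>x\<bar>)"
    using class_C_growth[OF assms(1)] by blast
  have "\<eta>\<^sup>2 < 1" using \<eta> by (simp add: power_less_one_iff abs_less_iff)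
  then have "0 \<le> 1 - \<eta>\<^sup>2 / 2" "1 - \<eta>\<^sup>2 / 2 < 1" using \<eta>(1) by auto
  from AE_pair_of_AE_vec2[OF AE_fast_growth[OF this]] AE_energy_nonzero
  show ?thesis
  proof eventually_elim
    case (elim p)
    obtain \<phi>\<^sub>0 v\<^sub>0 where p: "p = (\<phi>\<^sub>0, v\<^sub>0)" by (cases p)
    show ?case
      unfolding p prod.case
    proof (intro impI allI)
      fix T a \<phi> v
      assume e: "0 \<le> energy V \<phi>\<^sub>0 v\<^sub>0" and max: "maximal_collapsing_solution V T a \<phi> v"
        and init: "\<phi> 0 = \<phi>\<^sub>0" "v 0 = v\<^sub>0"
      have pos: "0 < energy V \<phi>\<^sub>0 v\<^sub>0" using elim(2) e by (simp add: p)
      then obtain N0 :: nat where "\<And>t. t \<in> lifespan T \<Longrightarrow> real N0 \<le> log_contraction a t \<Longrightarrow>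
          exp (2 * sqrt 3 * (1 - \<eta>\<^sup>2 / 2) * (log_contraction a t - 1)) \<le> energy V (\<phi> t) (v t)"
        using elim(1) max init unfolding p prod.case by blast
      then show "\<exists>t\<^sub>s. singular_at V T a \<phi> v t\<^sub>s \<and> filterlim (\<lambda>t. \<bar>v t\<bar>) at_top (at_left t\<^sub>s)"
        using fast_growth_imp_singular[OF max _ \<eta> growth] pos init by blast
    qed
  qed
qed

end
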